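(* There is an absolute constant $C>0$ such that the following holds. Let $\mathbf{P}$ be a symmetric GAP of rank $d\ge 0$ in a torsion-free additive group $G$, and let $t\ge 1$ be real. Then there exists a $t$-proper symmetric GAP $\mathbf{Q}$ in $G$ of rank at most $d$ such that $$\operatorname{Image}(\mathbf{P}_{t'})\subseteq \operatorname{Image}(\mathbf{Q}_{t'})\quad\text{for all } t'>0,$$ $$\operatorname{Image}(\mathbf{Q}_{tt'})\subseteq \operatorname{Image}\big(\mathbf{P}_{(Cd)^{3d/2}tt'}\big)\quad\text{for all } t'\ge 1.$$ In particular, $\operatorname{Image}(\mathbf{P})\subseteq\operatorname{Image}(\mathbf{Q})\subseteq\operatorname{Image}\big(\mathbf{P}_{(Cd)^{3d/2}t}\big)$. Also $$\operatorname{size}(\mathbf{P})\le\operatorname{size}(\mathbf{Q})\le t^d\,(Cd)^{3d^2/2}\operatorname{size}(\mathbf{P}).$$ Finally, if $\mathbf{P}_{d^{3d/2}t}$ is not proper, then $\mathbf{Q}$ can be chosen to have rank at most $d-1$ while still being a $t$-proper symmetric GAP in $G$ satisfying $\operatorname{Image}(\mathbf{P}_{t'})\subseteq \operatorname{Image}(\mathbf{Q}_{t'})$ for all $t'>0$, $\operatorname{Image}(\mathbf{Q}_{tt'})\subseteq \operatorname{Image}\big(\mathbf{P}_{(Cd)^{3d/2}tt'}\big)$ for all $t'\ge 1$, and $\operatorname{size}(\mathbf{P})\le\operatorname{size}(\mathbf{Q})\le t^d\,(Cd)^{3d^2/2}\operatorname{size}(\mathbf{P})$.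
   Context: An additive group is an abelian group written additively; it is torsion-free if $nx\ne 0$ for all nonzero $x\in G$ and all nonzero integers $n$. A symmetric generalized arithmetic progression (symmetric GAP) in $G$ is a triple $\mathbf{P}=(N,v,d)$, where $d=\operatorname{rank}(\mathbf{P})\ge 0$ is an integer, $N=(N_1,\dots,N_d)$ is a tuple of positive reals (the dimensions) and $v=(v_1,\dots,v_d)$ is a tuple of elements of $G$ (the steps). Its image is $\operatorname{Image}(\mathbf{P}):=\{\sum_{i=1}^d n_iv_i: n_i\in\mathbb{Z},\ |n_i|\le N_i\}\subseteq G$, and its size is $\operatorname{size}(\mathbf{P}):=|\operatorname{Image}(\mathbf{P})|$. For real $t>0$ the dilate is $\mathbf{P}_t:=(tN,v,d)$. $\mathbf{P}$ is proper if the elements $\sum_i n_iv_i$, for integers $n_i$ with $|n_i|\le N_i$, are all distinct; it is $t$-proper if $\mathbf{P}_t$ is proper. Convention: $0^0=1$. *)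

theory Defs
  imports Complex_Main "HOL-Library.FuncSet" "HOL-Algebra.Algebra"
begin

text \<open>
  Additive groups are rendered by the locale \<open>comm_group\<close>, so \<open>n x\<close> is written
  \<open>x [^]\<^bsub>G\<^esub> n\<close> and sums are \<open>finprod\<close>.
\<close>

definition torsion_free :: "('a, 'm) monoid_scheme \<Rightarrow> bool" where
  "torsion_free G \<longleftrightarrow>
     (\<forall>x\<in>carrier G. \<forall>n::int. x \<noteq> \<one>\<^bsub>G\<^esub> \<longrightarrow> n \<noteq> 0 \<longrightarrow> x [^]\<^bsub>G\<^esub> n \<noteq> \<one>\<^bsub>G\<^esub>)"

text \<open>
  The triple \<open>(N, v, d)\<close>. The tuples are indexed by \<open>i < d\<close>; the values of the two
  functions at \<open>i \<ge> d\<close> play no role.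
\<close>

datatype 'a gap = GAP (dims: "nat \<Rightarrow> real") (steps: "nat \<Rightarrow> 'a") (gap_rank: nat)

definition sym_gap :: "('a, 'm) monoid_scheme \<Rightarrow> 'a gap \<Rightarrow> bool" where
  "sym_gap G P \<longleftrightarrow> (\<forall>i<gap_rank P. 0 < dims P i \<and> steps P i \<in> carrier G)"

definition coeffs :: "'a gap \<Rightarrow> (nat \<Rightarrow> int) set" where
  "coeffs P = (\<Pi>\<^sub>E i\<in>{..<gap_rank P}. {k. \<bar>real_of_int k\<bar> \<le> dims P i})"

definition gap_elem :: "('a, 'm) monoid_scheme \<Rightarrow> 'a gap \<Rightarrow> (nat \<Rightarrow> int) \<Rightarrow> 'a" where
  "gap_elem G P n = (\<Otimes>\<^bsub>G\<^esub>i\<in>{..<gap_rank P}. steps P i [^]\<^bsub>G\<^esub> n i)"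

definition gap_image :: "('a, 'm) monoid_scheme \<Rightarrow> 'a gap \<Rightarrow> 'a set" where
  "gap_image G P = gap_elem G P ` coeffs P"

definition gap_size :: "('a, 'm) monoid_scheme \<Rightarrow> 'a gap \<Rightarrow> nat" where
  "gap_size G P = card (gap_image G P)"

definition dilate :: "real \<Rightarrow> 'a gap \<Rightarrow> 'a gap" where
  "dilate t P = GAP (\<lambda>i. t * dims P i) (steps P) (gap_rank P)"

definition proper :: "('a, 'm) monoid_scheme \<Rightarrow> 'a gap \<Rightarrow> bool" where
  "proper G P \<longleftrightarrow> inj_on (gap_elem G P) (coeffs P)"

definition t_proper :: "('a, 'm) monoid_scheme \<Rightarrow> real \<Rightarrow> 'a gap \<Rightarrow> bool" where
  "t_proper G t P \<longleftrightarrow> proper G (dilate t P)"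

text \<open>Real powers with \<open>0\<^sup>0 = 1\<close>; in HOL, \<open>0 powr 0 = 0\<close>.\<close>

definition rpow :: "real \<Rightarrow> real \<Rightarrow> real" where
  "rpow x a = (if a = 0 then 1 else x powr a)"

definition proper_container ::
    "('a, 'm) monoid_scheme \<Rightarrow> real \<Rightarrow> 'a gap \<Rightarrow> real \<Rightarrow> 'a gap \<Rightarrow> bool" where
  "proper_container G C P t Q \<longleftrightarrow>
     (let d = gap_rank P; K = rpow (C * real d) (3 * real d / 2) in
       sym_gap G Q \<and> t_proper G t Q \<and>
       (\<forall>t'>0. gap_image G (dilate t' P) \<subseteq> gap_image G (dilate t' Q)) \<and>
       (\<forall>t'\<ge>1. gap_image G (dilate (t * t') Q) \<subseteq> gap_image G (dilate (K * t * t') P)) \<and>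
       gap_size G P \<le> gap_size G Q \<and>
       real (gap_size G Q)
         \<le> t ^ d * rpow (C * real d) (3 * (real d)\<^sup>2 / 2) * real (gap_size G P))"

definition containment_property :: "real \<Rightarrow> ('a, 'm) monoid_scheme \<Rightarrow> bool" where
  "containment_property C G \<longleftrightarrow>
     (\<forall>P t. sym_gap G P \<longrightarrow> 1 \<le> t \<longrightarrow>
       (\<exists>Q. gap_rank Q \<le> gap_rank P \<and> proper_container G C P t Q \<and>
          gap_image G P \<subseteq> gap_image G Q \<and>
          gap_image G Q
            \<subseteq> gap_image G (dilate (rpow (C * real (gap_rank P)) (3 * real (gap_rank P) / 2) * t) P)) \<and>
       (\<not> proper G (dilate (rpow (real (gap_rank P)) (3 * real (gap_rank P) / 2) * t) P) \<longrightarrow>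
          (\<exists>Q. gap_rank Q < gap_rank P \<and> proper_container G C P t Q)))"

text \<open>
  The constant \<open>C\<close> has to be absolute, i.e. the same for every group \<open>G\<close>. In HOL one cannot
  quantify over types inside a formula, and in \<open>\<exists>C. \<forall>G :: 'a monoid. \<dots>\<close> the witness
  could depend on the type \<open>'a\<close>. Hence \<open>C\<close> is a closed term of type real without
  type parameters: it is chosen from the constants that work for all groups with carrier in the
  naturals, i.e. up to isomorphism for all countable groups. That it works
  for groups over arbitrary types is not part of this definition and has to be proved. This
  choice loses nothing, since a GAP generates a countable subgroup, so the constants
  valid for countable torsion-free groups are those valid for all torsion-free groups.
\<close>

definition gap_const :: real where
  "gap_const = (SOME C. C > 0 \<and>
     (\<forall>G :: nat monoid. comm_group G \<longrightarrow> torsion_free G \<longrightarrow> containment_property C G))"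

end

theory Submission
  imports Defs "HOL-Analysis.Inner_Product" "HOL-Library.Countable_Set"
begin

text \<open>
  Rescaling the box of \<open>P\<close> to the unit cube turns \<open>P\<close> into an additive map \<open>\<phi>\<close> from a lattice
  \<open>L\<close> of rank \<open>d\<close> in Euclidean space to \<open>G\<close>; ball and cube differ by a factor \<open>sqrt d\<close> only. A failure
  of properness is a short nonzero vector \<open>x\<close> of \<open>L\<close> with trivial image, and since \<open>G\<close> is torsion-free,
  \<open>\<phi>\<close> descends to the orthogonal projection of \<open>L\<close> along \<open>x\<close>, a lattice of smaller rank: balls project
  into balls, and lifting back costs \<open>norm x / 2\<close>. In a Korkine-Zolotarev reduced basis \<open>w\<close>
  of a lattice of rank \<open>r\<close>, coefficients satisfy \<open>\<bar>c\<^sub>i\<bar> * norm w\<^sub>i \<le> 2 ^ r * r! * norm (\<Sum>j. c\<^sub>j w\<^sub>j)\<close>, so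
  the GAP with steps \<open>\<phi> w\<^sub>i\<close> and dimensions proportional to \<open>1 / norm w\<^sub>i\<close> is comparable to the images
  of balls. If it is \<open>t\<close>-proper we are done, and otherwise its kernel vector is
  projected away. The lifting costs add up, so the total dilation stays below
  \<open>2 ^ r * (r + 1)!\<close>, well within \<open>(C d) powr (3 d / 2)\<close>.
\<close>

subsection \<open>Discrete subgroups and reduced bases\<close>

text \<open>Lattices without a chosen basis. Finiteness of balls is the form in which discreteness
  is used: to find shortest vectors and to force coincidences among bounded vectors.\<close>

definition discrete_subgroup :: "'b::real_inner set \<Rightarrow> bool" where
  "discrete_subgroup L \<longleftrightarrow>
     0 \<in> L \<and> (\<forall>x\<in>L. \<forall>y\<in>L. x - y \<in> L) \<and> (\<forall>R. finite {x\<in>L. norm x \<le> R})"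

text \<open>A spanning set instead of a dimension: upper bounds suffice for the inductions on the
  rank, and the ambient space may be infinite-dimensional.\<close>

definition rank_le :: "'b::real_vector set \<Rightarrow> nat \<Rightarrow> bool" where
  "rank_le L r \<longleftrightarrow> (\<exists>S. finite S \<and> card S \<le> r \<and> L \<subseteq> span S)"

text \<open>For \<open>x = 0\<close> division by zero makes this the identity, so the algebraic
  facts below hold without \<open>x \<noteq> 0\<close>.\<close>

definition proj :: "'b::real_inner \<Rightarrow> 'b \<Rightarrow> 'b" where
  "proj x y = y - (inner x y / inner x x) *\<^sub>R x"

lemma discrete_subgroupD:
  assumes "discrete_subgroup L"
  shows "0 \<in> L" "\<And>x y. x \<in> L \<Longrightarrow> y \<in> L \<Longrightarrow> x - y \<in> L" "\<And>R. finite {x\<in>L. norm x \<le> R}"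
  using assms by (auto simp: discrete_subgroup_def)

lemma discrete_subgroup_closed:
  fixes L :: "'b::real_inner set"
  assumes "discrete_subgroup L"
  shows "x \<in> L \<Longrightarrow> - x \<in> L" "x \<in> L \<Longrightarrow> y \<in> L \<Longrightarrow> x + y \<in> L"
    "x \<in> L \<Longrightarrow> real_of_int k *\<^sub>R x \<in> L"
    "finite A \<Longrightarrow> (\<And>i. i \<in> A \<Longrightarrow> f i \<in> L) \<Longrightarrow> sum f A \<in> L"
proof -
  note L = discrete_subgroupD(1,2)[OF assms]
  have neg: "- x \<in> L" if "x \<in> L" for x
    using L(2)[OF L(1) that] by simp
  have add: "x + y \<in> L" if "x \<in> L" "y \<in> L" for x y
    using L(2)[OF that(1) neg[OF that(2)]] by simp
  have nat: "real n *\<^sub>R x \<in> L" if "x \<in> L" for x n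
    by (induction n) (auto simp: L(1) algebra_simps intro: add that)
  show "x \<in> L \<Longrightarrow> - x \<in> L" by (rule neg)
  show "x \<in> L \<Longrightarrow> y \<in> L \<Longrightarrow> x + y \<in> L" by (rule add)
  show "real_of_int k *\<^sub>R x \<in> L" if "x \<in> L"
    using nat[OF that, of "nat k"] neg[OF nat[OF that, of "nat (- k)"]] by (cases "k \<ge> 0") auto
  show "finite A \<Longrightarrow> (\<And>i. i \<in> A \<Longrightarrow> f i \<in> L) \<Longrightarrow> sum f A \<in> L"
    by (induction A rule: finite_induct) (auto simp: L(1) intro: add)
qed

section \<open>Orthogonal projection of a lattice along one of its vectors\<close>

lemma linear_proj: "linear (proj x)"
  unfolding proj_def
  by (rule linearI) (auto simp: inner_add_right add_divide_distrib algebra_simps)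

lemma proj_self [simp]: "proj x x = 0"
  by (simp add: proj_def)

text \<open>Pythagoras for the splitting of \<open>y\<close> into its parts orthogonal to and along
  \<open>x\<close>.\<close>

lemma norm_eq_proj:
  "(norm y)\<^sup>2 = (norm (proj x y))\<^sup>2 + (inner x y / inner x x)\<^sup>2 * (norm x)\<^sup>2"
proof -
  define c where "c = inner x y / inner x x"
  have c: "c * inner x x = inner x y"
    by (cases "x = 0") (simp_all add: c_def)
  have "(norm (proj x y))\<^sup>2 = inner y y - 2 * c * inner x y + c * (c * inner x x)"
    by (simp add: proj_def c_def[symmetric] power2_norm_eq_inner inner_diff_left inner_diff_right
        inner_commute[of y x] algebra_simps)
  then show ?thesis
    unfolding c_def[symmetric] power2_norm_eq_inner[of x] power2_norm_eq_inner[of y]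
    using c by (simp add: power2_eq_square mult.assoc)
qed

lemma norm_proj_le: "norm (proj x y) \<le> norm y"
  by (rule power2_le_imp_le) (auto simp: norm_eq_proj[of y x])

lemma proj_add_scaleR: "proj x (y + c *\<^sub>R x) = proj x y"
  by (simp add: linear_add[OF linear_proj] linear_scale[OF linear_proj])

text \<open>Adding integer multiples of \<open>x\<close> keeps the projection and shifts the
  coordinate along \<open>x\<close> by integers, so rounding brings that coordinate down to at most
  1/2.\<close>

lemma ex_short_lift:
  assumes "x \<noteq> 0"
  shows "\<exists>k::int. (norm (y + of_int k *\<^sub>R x))\<^sup>2 \<le> (norm (proj x y))\<^sup>2 + (norm x)\<^sup>2 / 4"
proof -
  define c where "c = inner x y / inner x x"
  define z where "z = y + of_int (- round c) *\<^sub>R x"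
  have pz: "proj x z = proj x y"
    unfolding z_def by (rule proj_add_scaleR)
  have "inner x z / inner x x = c - of_int (round c)"
    using assms by (simp add: z_def c_def inner_diff_right diff_divide_distrib)
  moreover have "\<bar>c - of_int (round c)\<bar> \<le> \<bar>1 / 2\<bar>"
    using of_int_round_abs_le[of c] by linarith
  then have "(c - of_int (round c))\<^sup>2 \<le> (1 / 2)\<^sup>2"
    by (simp only: abs_le_square_iff)
  ultimately have "(norm z)\<^sup>2 \<le> (norm (proj x y))\<^sup>2 + (1/2)\<^sup>2 * (norm x)\<^sup>2"
    using norm_eq_proj[of z x] by (simp add: pz mult_right_mono)
  then show ?thesis
    unfolding z_def by (intro exI[of _ "- round c"]) (simp add: power2_eq_square)
qed

lemma ex_short_lift_norm:
  assumes "x \<noteq> 0"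
  shows "\<exists>k::int. norm (y + of_int k *\<^sub>R x) \<le> norm (proj x y) + norm x / 2"
proof -
  obtain k :: int where k: "(norm (y + of_int k *\<^sub>R x))\<^sup>2 \<le> (norm (proj x y))\<^sup>2 + (norm x)\<^sup>2 / 4"
    using ex_short_lift[OF assms] by blast
  have "(norm (proj x y))\<^sup>2 + (norm x)\<^sup>2 / 4 \<le> (norm (proj x y) + norm x / 2)\<^sup>2"
    by (simp add: power2_eq_square algebra_simps)
  from order_trans[OF k this] have "norm (y + of_int k *\<^sub>R x) \<le> norm (proj x y) + norm x / 2"
    by (rule power2_le_imp_le) simp
  then show ?thesis by blast
qed

text \<open>A projected vector of norm at most \<open>R\<close> has a lift in \<open>L\<close> of
  norm at most \<open>R + norm x / 2\<close>, and \<open>L\<close> has finitely many of those. The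
  lift stays in \<open>L\<close> because \<open>x\<close> is a lattice vector.\<close>

lemma discrete_subgroup_proj:
  assumes L: "discrete_subgroup L" and x: "x \<in> L" "x \<noteq> 0"
  shows "discrete_subgroup (proj x ` L)"
  unfolding discrete_subgroup_def
proof (intro conjI ballI allI)
  show "0 \<in> proj x ` L"
    using x(1) by (force intro: image_eqI[of _ _ x])
  show "y - z \<in> proj x ` L" if "y \<in> proj x ` L" "z \<in> proj x ` L" for y z
    using that discrete_subgroupD(2)[OF L] by (auto simp flip: linear_diff[OF linear_proj])
  fix R
  have "{y \<in> proj x ` L. norm y \<le> R} \<subseteq> proj x ` {y\<in>L. norm y \<le> R + norm x / 2}"
  proof clarify
    fix y assume y: "y \<in> L" "norm (proj x y) \<le> R"
    obtain k :: int where "norm (y + of_int k *\<^sub>R x) \<le> norm (proj x y) + norm x / 2"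
      using ex_short_lift_norm[OF x(2)] by blast
    then show "proj x y \<in> proj x ` {y\<in>L. norm y \<le> R + norm x / 2}"
      using y discrete_subgroup_closed[OF L] x
      by (intro image_eqI[of _ _ "y + of_int k *\<^sub>R x"]) (auto simp: proj_add_scaleR)
  qed
  then show "finite {y \<in> proj x ` L. norm y \<le> R}"
    using discrete_subgroupD(3)[OF L] by (meson finite_imageI finite_subset)
qed

text \<open>Steinitz exchange for a spanning set that need not be independent: \<open>s\<close> is
  the element whose addition first puts \<open>x\<close> into the span.\<close>

lemma ex_exchange:
  fixes x :: "'b::real_vector"
  assumes "finite S" "x \<in> span S" "x \<noteq> 0"
  shows "\<exists>s\<in>S. S \<subseteq> span (insert x (S - {s}))"
  using assms
proof (induction S rule: finite_induct)
  case empty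
  then show ?case by simp
next
  case (insert b F)
  show ?case
  proof (cases "x \<in> span F")
    case True
    then obtain s where s: "s \<in> F" "F \<subseteq> span (insert x (F - {s}))"
      using insert by blast
    have "insert x (F - {s}) \<subseteq> insert x (insert b F - {s})" by auto
    then have "F \<subseteq> span (insert x (insert b F - {s}))"
      using s(2) span_mono by blast
    moreover have "b \<in> insert x (insert b F - {s})"
      using s(1) insert(2) by auto
    ultimately show ?thesis
      using s(1) by (intro bexI[of _ s]) (auto intro: span_base)
  next
    case False
    then have "b \<in> span (insert x F)"
      using in_span_insert insert.prems(1) by blast
    moreover have "insert b F - {b} = F" using insert(2) by auto
    ultimately show ?thesis
      by (intro bexI[of _ b]) (auto intro: span_base)
  qed
qed

text \<open>Exchange one spanning vector for \<open>x\<close>; the projection kills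
  \<open>x\<close>, so the images of the remaining ones span the projected lattice.\<close>

lemma rank_le_proj:
  assumes "rank_le L r" "x \<in> L" "x \<noteq> 0"
  shows "0 < r \<and> rank_le (proj x ` L) (r - 1)"
proof -
  obtain S where S: "finite S" "card S \<le> r" "L \<subseteq> span S"
    using assms by (auto simp: rank_le_def)
  obtain s where s: "s \<in> S" "S \<subseteq> span (insert x (S - {s}))"
    using ex_exchange[OF S(1) _ assms(3)] S(3) assms(2) by blast
  have "L \<subseteq> span (insert x (S - {s}))"
    using S(3) span_mono[OF s(2)] unfolding span_span by blast
  then have "proj x ` L \<subseteq> span (proj x ` insert x (S - {s}))"
    by (metis image_mono linear_proj linear_span_image)
  then have "proj x ` L \<subseteq> span (proj x ` (S - {s}))"
    by simp
  moreover have "card (proj x ` (S - {s})) \<le> r - 1"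
    using S(1,2) s(1) card_image_le[of "S - {s}" "proj x"] by (simp add: card_Diff_singleton)
  moreover have "0 < r"
    using S(1,2) s(1) by (cases "r = 0") auto
  ultimately show ?thesis
    unfolding rank_le_def using S(1) by (intro conjI exI[of _ "proj x ` (S - {s})"]) auto
qed

section \<open>Shortest vectors and Korkine-Zolotarev reduction\<close>

lemma discrete_subgroup_ex_shortest:
  assumes L: "discrete_subgroup L" and "\<not> L \<subseteq> {0}"
  shows "\<exists>x\<in>L. x \<noteq> 0 \<and> (\<forall>y\<in>L. y \<noteq> 0 \<longrightarrow> norm x \<le> norm y)"
proof -
  obtain z where z: "z \<in> L" "z \<noteq> 0" using assms(2) by auto
  define A where "A = {y\<in>L. norm y \<le> norm z} - {0}"
  have A: "finite A" "A \<noteq> {}"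
    using discrete_subgroupD(3)[OF L] z by (auto simp: A_def)
  define x where "x = arg_min_on norm A"
  have x: "x \<in> A" "\<And>y. y \<in> A \<Longrightarrow> norm x \<le> norm y"
    using arg_min_if_finite[OF A, of norm] by (auto simp: x_def not_less)
  have "norm x \<le> norm y" if "y \<in> L" "y \<noteq> 0" for y
    using x that by (cases "y \<in> A") (auto simp: A_def)
  with x(1) show ?thesis by (auto simp: A_def)
qed

text \<open>
  The last clause bounds the product of a basis vector's length and its dual vector's length; it
  also makes the basis linearly independent.
\<close>

definition reduced_basis :: "'b::real_inner set \<Rightarrow> real \<Rightarrow> nat \<Rightarrow> (nat \<Rightarrow> 'b) \<Rightarrow> bool" where
  "reduced_basis L A n w \<longleftrightarrow>
     (\<forall>i<n. w i \<in> L \<and> w i \<noteq> 0) \<and>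
     (\<forall>y\<in>L. \<exists>c::nat \<Rightarrow> int. y = (\<Sum>i<n. of_int (c i) *\<^sub>R w i)) \<and>
     (\<forall>c::nat \<Rightarrow> int. \<forall>i<n. \<bar>of_int (c i)\<bar> * norm (w i) \<le> A * norm (\<Sum>j<n. of_int (c j) *\<^sub>R w j))"

text \<open>One step of the reduction: the basis of the projected lattice is lifted to short vectors
  and the shortest vector \<open>x\<close> is appended. Lifting loses a factor 2 in the old
  coefficient bounds; bounding the coefficient of \<open>x\<close> by a triangle inequality over
  \<open>n\<close> terms gives the factor \<open>Suc n\<close>.\<close>

lemma reduced_basis_extend:
  fixes x :: "'b::real_inner"
  assumes L: "discrete_subgroup L" and x: "x \<in> L" "x \<noteq> 0"
    and short: "\<And>y. y \<in> L \<Longrightarrow> y \<noteq> 0 \<Longrightarrow> norm x \<le> norm y"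
    and red: "reduced_basis (proj x ` L) A n w" and A: "1 \<le> A"
  shows "\<exists>w'. reduced_basis L (2 * real (Suc n) * A) (Suc n) w'"
proof -
  have red1: "\<And>i. i < n \<Longrightarrow> w i \<in> proj x ` L \<and> w i \<noteq> 0"
    and red2: "\<And>y. y \<in> L \<Longrightarrow> \<exists>c::nat \<Rightarrow> int. proj x y = (\<Sum>i<n. of_int (c i) *\<^sub>R w i)"
    and red3: "\<And>(c::nat \<Rightarrow> int) i. i < n \<Longrightarrow> \<bar>of_int (c i)\<bar> * norm (w i) \<le> A * norm (\<Sum>j<n. of_int (c j) *\<^sub>R w j)"
    using red unfolding reduced_basis_def by blast+
  have "\<exists>u\<in>L. proj x u = w i \<and> norm u ^ 2 \<le> norm (w i) ^ 2 + norm x ^ 2 / 4" if "i < n" for i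
  proof -
    obtain y where y: "y \<in> L" "w i = proj x y" using red1 \<open>i < n\<close> by blast
    obtain k :: int where "norm (y + of_int k *\<^sub>R x) ^ 2 \<le> norm (w i) ^ 2 + norm x ^ 2 / 4"
      using ex_short_lift[OF x(2), of y] y(2) by auto
    then show ?thesis
      using y x discrete_subgroup_closed[OF L]
      by (intro bexI[of _ "y + of_int k *\<^sub>R x"]) (auto simp: proj_add_scaleR)
  qed
  then obtain u where u: "\<And>i. i < n \<Longrightarrow> u i \<in> L" "\<And>i. i < n \<Longrightarrow> proj x (u i) = w i"
    "\<And>i. i < n \<Longrightarrow> norm (u i) ^ 2 \<le> norm (w i) ^ 2 + norm x ^ 2 / 4"
    by metis
  have u0: "u i \<noteq> 0" if "i < n" for i
    using u(2)[OF that] red1[OF that] by (auto simp: linear_0[OF linear_proj])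
  \<comment> \<open>As \<open>x\<close> is shortest, the excess \<open>norm x ^ 2 / 4\<close> is at
    most a quarter of \<open>norm (u i) ^ 2\<close> and can be absorbed.\<close>
  have xu: "norm x \<le> norm (u i)" "norm (u i) \<le> 2 * norm (w i)" if "i < n" for i
  proof -
    show *: "norm x \<le> norm (u i)" using short u u0 that by auto
    then have "norm x ^ 2 \<le> norm (u i) ^ 2" by (simp add: power_mono)
    moreover have "(2 * norm (w i)) ^ 2 = 4 * norm (w i) ^ 2" "0 \<le> norm (w i) ^ 2"
      by (simp_all add: power_mult_distrib)
    ultimately have "norm (u i) ^ 2 \<le> (2 * norm (w i)) ^ 2"
      using u(3)[OF that] by linarith
    then show "norm (u i) \<le> 2 * norm (w i)" by (rule power2_le_imp_le) simp
  qed
  define w' where "w' = u(n := x)"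
  have sum': "(\<Sum>i<Suc n. of_int (c i) *\<^sub>R w' i) = (\<Sum>i<n. of_int (c i) *\<^sub>R u i) + of_int (c n) *\<^sub>R x"
    for c :: "nat \<Rightarrow> int"
    by (simp add: w'_def)
  have projsum: "proj x (\<Sum>i<n. of_int (c i) *\<^sub>R u i) = (\<Sum>i<n. of_int (c i) *\<^sub>R w i)" for c :: "nat \<Rightarrow> int"
    by (simp add: linear_sum[OF linear_proj] linear_scale[OF linear_proj] u(2))
  have "reduced_basis L (2 * real (Suc n) * A) (Suc n) w'"
    unfolding reduced_basis_def
  proof (intro conjI allI impI ballI)
    fix i assume "i < Suc n"
    then show "w' i \<in> L" "w' i \<noteq> 0"
      using u(1) u0 x by (auto simp: w'_def less_Suc_eq)
  next
    fix y assume y: "y \<in> L"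
    obtain c :: "nat \<Rightarrow> int" where c: "proj x y = (\<Sum>i<n. of_int (c i) *\<^sub>R w i)"
      using red2[OF y] by blast
    define v where "v = (\<Sum>i<n. of_int (c i) *\<^sub>R u i)"
    define z where "z = y - v"
    have "v \<in> L"
      unfolding v_def using u(1) by (intro discrete_subgroup_closed[OF L]) auto
    then have z: "z \<in> L" "proj x z = 0"
      using y discrete_subgroupD(2)[OF L]
      by (auto simp: z_def v_def linear_diff[OF linear_proj] c projsum)
    obtain k :: int where k: "norm (z + of_int k *\<^sub>R x) ^ 2 \<le> norm (proj x z) ^ 2 + norm x ^ 2 / 4"
      using ex_short_lift[OF x(2)] by blast
    \<comment> \<open>\<open>z\<close> lies on the line of \<open>x\<close>, so the shifted vector
      has norm at most \<open>norm x / 2\<close>, and minimality of \<open>norm x\<close> leaves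
      only zero.\<close>
    have "z + of_int k *\<^sub>R x = 0"
    proof (rule ccontr)
      assume "z + of_int k *\<^sub>R x \<noteq> 0"
      then have "norm x \<le> norm (z + of_int k *\<^sub>R x)"
        using short discrete_subgroup_closed[OF L] z x by auto
      then have "norm x ^ 2 \<le> norm (z + of_int k *\<^sub>R x) ^ 2" by (rule power_mono) simp
      moreover have "norm x ^ 2 > 0" using x by simp
      moreover have "norm (proj x z) ^ 2 = 0" using z(2) by simp
      ultimately show False using k by linarith
    qed
    then have "z = of_int (- k) *\<^sub>R x"
      by (metis add_eq_0_iff2 of_int_minus scaleR_minus_left)
    moreover have "(\<Sum>i<n. of_int ((c(n := - k)) i) *\<^sub>R u i) = v"
      unfolding v_def by (intro sum.cong) auto
    moreover have "y = v + z" by (simp add: z_def)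
    ultimately have "y = (\<Sum>i<Suc n. of_int ((c(n := - k)) i) *\<^sub>R w' i)"
      unfolding sum' by simp
    then show "\<exists>c::nat \<Rightarrow> int. y = (\<Sum>i<Suc n. of_int (c i) *\<^sub>R w' i)"
      by blast
  next
    fix c :: "nat \<Rightarrow> int" and i assume i: "i < Suc n"
    define v where "v = (\<Sum>i<n. of_int (c i) *\<^sub>R u i)"
    define s where "s = v + of_int (c n) *\<^sub>R x"
    have "proj x s = (\<Sum>i<n. of_int (c i) *\<^sub>R w i)"
      unfolding s_def v_def by (simp add: proj_add_scaleR projsum)
    then have "norm (\<Sum>i<n. of_int (c i) *\<^sub>R w i) \<le> norm s"
      by (metis norm_proj_le)
    then have ns: "A * norm (\<Sum>i<n. of_int (c i) *\<^sub>R w i) \<le> A * norm s"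
      using A by (intro mult_left_mono) auto
    \<comment> \<open>Coefficients of the lifted vectors can be read off in the projection, where
      the multiple of \<open>x\<close> is invisible and norms only shrink.\<close>
    have cu: "\<bar>of_int (c i)\<bar> * norm (u i) \<le> 2 * A * norm s" if "i < n" for i
    proof -
      have "\<bar>of_int (c i)\<bar> * norm (u i) \<le> \<bar>of_int (c i)\<bar> * (2 * norm (w i))"
        using xu(2)[OF that] by (intro mult_left_mono) auto
      with red3[OF that, of c] ns show ?thesis by linarith
    qed
    \<comment> \<open>The multiple of \<open>x\<close> is what remains of \<open>s\<close> after
      removing the lifted part, whose terms are bounded by \<open>cu\<close>.\<close>
    have "\<bar>of_int (c n)\<bar> * norm x = norm (s - v)"
      by (simp add: s_def)
    also have "\<dots> \<le> norm s + norm v"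
      by (rule norm_triangle_ineq4)
    also have "norm v \<le> (\<Sum>i<n. 2 * A * norm s)"
      unfolding v_def using cu by (intro sum_norm_le) simp
    also have "\<dots> = real n * (2 * A * norm s)" by simp
    finally have "\<bar>of_int (c n)\<bar> * norm x \<le> norm s + real n * (2 * A * norm s)"
      by simp
    moreover have "norm s \<le> 2 * A * norm s"
      using A mult_right_mono[of 1 "2 * A" "norm s"] by simp
    moreover have "2 * real (Suc n) * A * norm s = 2 * A * norm s + real n * (2 * A * norm s)"
      by (simp add: algebra_simps)
    ultimately have cx: "\<bar>of_int (c n)\<bar> * norm x \<le> 2 * real (Suc n) * A * norm s"
      by linarith
    have "2 * A * norm s \<le> 2 * real (Suc n) * A * norm s"
      using A by (intro mult_right_mono) auto
    then show "\<bar>of_int (c i)\<bar> * norm (w' i)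
        \<le> 2 * real (Suc n) * A * norm (\<Sum>j<Suc n. of_int (c j) *\<^sub>R w' j)"
      unfolding sum' using i cx cu[of i] by (fastforce simp: w'_def s_def v_def less_Suc_eq)
  qed
  then show ?thesis by blast
qed

text \<open>Projecting along a shortest vector lowers the rank bound, and the factors
  \<open>2 * Suc n\<close> with \<open>n \<le> r\<close> multiply up to at most
  \<open>2 ^ r * fact r\<close>. The trivial lattice has the empty basis, so \<open>n\<close> may be
  smaller than the rank bound.\<close>

lemma ex_reduced_basis:
  assumes "discrete_subgroup L" "rank_le L r"
  shows "\<exists>n\<le>r. \<exists>w. reduced_basis L (2 ^ r * fact r) n w"
  using assms
proof (induction r arbitrary: L)
  case 0
  then have "L \<subseteq> {0}" by (auto simp: rank_le_def)
  then show ?case by (auto simp: reduced_basis_def)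
next
  case (Suc r)
  show ?case
  proof (cases "L \<subseteq> {0}")
    case True
    then show ?thesis by (intro exI[of _ 0]) (auto simp: reduced_basis_def)
  next
    case False
    then obtain x where x: "x \<in> L" "x \<noteq> 0" "\<And>y. y \<in> L \<Longrightarrow> y \<noteq> 0 \<Longrightarrow> norm x \<le> norm y"
      using discrete_subgroup_ex_shortest[OF Suc.prems(1)] by blast
    have "discrete_subgroup (proj x ` L)" "rank_le (proj x ` L) r"
      using discrete_subgroup_proj[OF Suc.prems(1) x(1,2)] rank_le_proj[OF Suc.prems(2) x(1,2)] by auto
    then obtain n w where n: "n \<le> r" "reduced_basis (proj x ` L) (2 ^ r * fact r) n w"
      using Suc.IH by blast
    have "(1::real) \<le> 2 ^ r * fact r"
      using mult_mono[of "1::real" "2 ^ r" 1 "fact r"] by simp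
    then obtain w' where w': "reduced_basis L (2 * real (Suc n) * (2 ^ r * fact r)) (Suc n) w'"
      using reduced_basis_extend[OF Suc.prems(1) x n(2)] by blast
    have "2 * real (Suc n) * (2 ^ r * fact r) \<le> (2 ^ Suc r * fact (Suc r) :: real)"
      using n(1) by (simp add: field_simps mult_left_mono)
    then have "reduced_basis L (2 ^ Suc r * fact (Suc r)) (Suc n) w'"
      using w' unfolding reduced_basis_def
      by (meson mult_right_mono norm_ge_zero order_trans)
    then show ?thesis using n(1) by auto
  qed
qed

subsection \<open>Additive maps on lattices\<close>

definition additive_map :: "('a, 'm) monoid_scheme \<Rightarrow> 'b::real_inner set \<Rightarrow> ('b \<Rightarrow> 'a) \<Rightarrow> bool" where
  "additive_map G L \<phi> \<longleftrightarrow>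
     (\<forall>x\<in>L. \<phi> x \<in> carrier G) \<and> (\<forall>x\<in>L. \<forall>y\<in>L. \<phi> (x + y) = \<phi> x \<otimes>\<^bsub>G\<^esub> \<phi> y)"

lemma additive_mapD:
  assumes "additive_map G L \<phi>"
  shows "\<And>x. x \<in> L \<Longrightarrow> \<phi> x \<in> carrier G"
    "\<And>x y. x \<in> L \<Longrightarrow> y \<in> L \<Longrightarrow> \<phi> (x + y) = \<phi> x \<otimes>\<^bsub>G\<^esub> \<phi> y"
  using assms by (auto simp: additive_map_def)

lemma additive_map_simps:
  assumes "comm_group G" and L: "discrete_subgroup L" and \<phi>: "additive_map G L \<phi>"
  shows "\<phi> 0 = \<one>\<^bsub>G\<^esub>"
    "\<And>x. x \<in> L \<Longrightarrow> \<phi> (- x) = inv\<^bsub>G\<^esub> (\<phi> x)"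
    "\<And>x y. x \<in> L \<Longrightarrow> y \<in> L \<Longrightarrow> \<phi> (x - y) = \<phi> x \<otimes>\<^bsub>G\<^esub> inv\<^bsub>G\<^esub> (\<phi> y)"
    "\<And>x k. x \<in> L \<Longrightarrow> \<phi> (of_int k *\<^sub>R x) = \<phi> x [^]\<^bsub>G\<^esub> (k::int)"
    "\<And>f (n::nat). (\<And>i. i < n \<Longrightarrow> f i \<in> L) \<Longrightarrow> \<phi> (\<Sum>i<n. f i) = (\<Otimes>\<^bsub>G\<^esub>i\<in>{..<n}. \<phi> (f i))"
proof -
  interpret comm_group G by fact
  note D = additive_mapD[OF \<phi>]
  note cl = discrete_subgroupD(1,2)[OF L] discrete_subgroup_closed[OF L]
  have "\<phi> 0 \<otimes>\<^bsub>G\<^esub> \<phi> 0 = \<phi> 0" using D(2)[of 0 0] cl(1) by simp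
  then show z: "\<phi> 0 = \<one>\<^bsub>G\<^esub>" using D(1)[OF cl(1)] by (simp add: l_cancel_one)
  have m: "\<phi> (- x) = inv\<^bsub>G\<^esub> (\<phi> x)" if "x \<in> L" for x
    using D(2)[of "- x" x] that cl D(1) z by (intro inv_equality[symmetric]) auto
  then show "\<And>x. x \<in> L \<Longrightarrow> \<phi> (- x) = inv\<^bsub>G\<^esub> (\<phi> x)" by blast
  show "\<And>x y. x \<in> L \<Longrightarrow> y \<in> L \<Longrightarrow> \<phi> (x - y) = \<phi> x \<otimes>\<^bsub>G\<^esub> inv\<^bsub>G\<^esub> (\<phi> y)"
    using D(2)[of _ "- _"] m cl(3) by (metis diff_conv_add_uminus)
  have nat: "\<phi> (real n *\<^sub>R x) = \<phi> x [^]\<^bsub>G\<^esub> n" if "x \<in> L" for x n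
  proof (induction n)
    case 0 then show ?case by (simp add: z)
  next
    case (Suc n)
    have "real n *\<^sub>R x \<in> L" using cl(5)[OF that, of "int n"] by simp
    then show ?case using Suc D that by (simp add: scaleR_add_left add.commute m_comm)
  qed
  show "\<phi> (of_int k *\<^sub>R x) = \<phi> x [^]\<^bsub>G\<^esub> k" if "x \<in> L" for x k
  proof (cases k rule: int_cases2)
    case (nonneg n)
    then show ?thesis using nat[OF that, of n] by (simp add: int_pow_int)
  next
    case (nonpos n)
    have "real n *\<^sub>R x \<in> L" using cl(5)[OF that, of "int n"] by simp
    then show ?thesis
      using nonpos m nat[OF that, of n] D(1)[OF that] by (simp add: int_pow_neg int_pow_int)
  qed
  show "\<phi> (\<Sum>i<n. f i) = (\<Otimes>\<^bsub>G\<^esub>i\<in>{..<n}. \<phi> (f i))" if "\<And>i. i < n \<Longrightarrow> f i \<in> L" for f and n :: nat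
    using that
  proof (induction n)
    case 0 then show ?case by (simp add: z)
  next
    case (Suc n)
    have "\<phi> (\<Sum>i<Suc n. f i) = \<phi> (f n + (\<Sum>i<n. f i))" by (simp add: add.commute)
    also have "\<dots> = \<phi> (f n) \<otimes>\<^bsub>G\<^esub> \<phi> (\<Sum>i<n. f i)"
      using Suc.prems by (intro D(2) cl(6)) auto
    also have "\<dots> = (\<Otimes>\<^bsub>G\<^esub>i\<in>{..<Suc n}. \<phi> (f i))"
      using Suc D(1) by (simp add: lessThan_Suc finprod_insert Pi_iff)
    finally show ?case .
  qed
qed

text \<open>
  Discreteness makes \<open>y\<close> a rational multiple of \<open>x\<close>: the fractional parts \<open>frac (m a) x\<close> are bounded lattice
  vectors, so two of them coincide.
\<close>

lemma additive_map_eq_one: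
  fixes L :: "'b::real_inner set"
  assumes G: "comm_group G" "torsion_free G" and L: "discrete_subgroup L" and \<phi>: "additive_map G L \<phi>"
    and x: "x \<in> L" "\<phi> x = \<one>\<^bsub>G\<^esub>" and y: "y \<in> L" "proj x y = 0"
  shows "\<phi> y = \<one>\<^bsub>G\<^esub>"
proof (rule ccontr)
  assume ne: "\<phi> y \<noteq> \<one>\<^bsub>G\<^esub>"
  interpret comm_group G by fact
  note simps = additive_map_simps[OF G(1) L \<phi>]
  define a where "a = inner x y / inner x x"
  have ya: "y = a *\<^sub>R x" using y(2) by (simp add: proj_def a_def)
  define f where "f m = of_int (int m) *\<^sub>R y - of_int \<lfloor>real m * a\<rfloor> *\<^sub>R x" for m :: nat
  have "f m \<in> {z\<in>L. norm z \<le> norm x}" for m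
  proof -
    have "f m = (real m * a - of_int \<lfloor>real m * a\<rfloor>) *\<^sub>R x"
      by (simp add: f_def ya algebra_simps)
    moreover have "\<bar>real m * a - of_int \<lfloor>real m * a\<rfloor>\<bar> \<le> 1" by linarith
    ultimately have "norm (f m) \<le> norm x"
      using mult_right_mono[of _ 1 "norm x"] by simp
    moreover have "f m \<in> L"
      unfolding f_def by (intro discrete_subgroupD(2)[OF L] discrete_subgroup_closed[OF L] x y)
    ultimately show ?thesis by simp
  qed
  then have "finite (range f)"
    by (intro finite_subset[OF _ discrete_subgroupD(3)[OF L, of "norm x"]]) blast
  then have "\<not> inj f" using finite_imageD[of f UNIV] by auto
  then obtain m n where mn: "m \<noteq> n" "f m = f n" by (auto simp: inj_on_def)
  define k where "k = \<lfloor>real m * a\<rfloor> - \<lfloor>real n * a\<rfloor>"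
  have "of_int (int m - int n) *\<^sub>R y = of_int k *\<^sub>R x"
    using mn(2) by (simp add: f_def k_def algebra_simps)
  then have "\<phi> y [^]\<^bsub>G\<^esub> (int m - int n) = \<phi> x [^]\<^bsub>G\<^esub> k"
    using simps(4)[OF y(1), of "int m - int n"] simps(4)[OF x(1), of k] by simp
  then have "\<phi> y [^]\<^bsub>G\<^esub> (int m - int n) = \<one>\<^bsub>G\<^esub>"
    using x(2) by simp
  moreover have "\<phi> y \<in> carrier G" "int m - int n \<noteq> 0"
    using additive_mapD(1)[OF \<phi> y(1)] mn(1) by auto
  ultimately show False
    using G(2) ne unfolding torsion_free_def by blast
qed

text \<open>Two lattice vectors with the same projection differ by a lattice vector on the line of
  \<open>x\<close>, which \<open>additive_map_eq_one\<close> sends to the identity. Hence any choice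
  of preimages defines the same \<open>\<psi>\<close>.\<close>

lemma ex_additive_map_proj:
  assumes G: "comm_group G" "torsion_free G" and L: "discrete_subgroup L" and \<phi>: "additive_map G L \<phi>"
    and x: "x \<in> L" "\<phi> x = \<one>\<^bsub>G\<^esub>"
  shows "\<exists>\<psi>. additive_map G (proj x ` L) \<psi> \<and> (\<forall>y\<in>L. \<psi> (proj x y) = \<phi> y)"
proof -
  interpret comm_group G by fact
  define \<psi> where "\<psi> = \<phi> \<circ> inv_into L (proj x)"
  have \<psi>: "\<psi> (proj x y) = \<phi> y" if y: "y \<in> L" for y
  proof -
    define z where "z = inv_into L (proj x) (proj x y)"
    have z: "z \<in> L" "proj x z = proj x y"
      using y by (auto simp: z_def inv_into_into f_inv_into_f)
    have "\<phi> (z - y) = \<one>\<^bsub>G\<^esub>"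
      using z y x discrete_subgroupD(2)[OF L]
      by (intro additive_map_eq_one[OF G L \<phi> x]) (auto simp: linear_diff[OF linear_proj])
    moreover have "\<phi> z = \<phi> (z - y) \<otimes>\<^bsub>G\<^esub> \<phi> y"
      using additive_mapD(2)[OF \<phi>, of "z - y" y] z y discrete_subgroupD(2)[OF L] by simp
    ultimately have "\<phi> z = \<phi> y"
      using additive_mapD(1)[OF \<phi> y] by simp
    then show ?thesis by (simp add: \<psi>_def z_def)
  qed
  have "additive_map G (proj x ` L) \<psi>"
    unfolding additive_map_def
    using additive_mapD[OF \<phi>] discrete_subgroup_closed(2)[OF L]
    by (auto simp: \<psi> simp flip: linear_add[OF linear_proj])
  then show ?thesis using \<psi> by blast
qed

subsection \<open>Generalized arithmetic progressions and images of balls\<close>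

lemma gap_elem_cong:
  assumes "comm_group G" "sym_gap G P" "\<And>i. i < gap_rank P \<Longrightarrow> m i = n i"
  shows "gap_elem G P m = gap_elem G P n"
proof -
  interpret comm_group G by fact
  show ?thesis
    unfolding gap_elem_def using assms by (intro finprod_cong') (auto simp: sym_gap_def)
qed

text \<open>Restricting to the indices below the rank turns any coefficient function into a member
  of \<open>coeffs\<close> with the same element, so later witnesses can be plain functions.\<close>

lemma gap_image_eq:
  assumes "comm_group G" "sym_gap G P"
  shows "gap_image G P = {gap_elem G P n | n. \<forall>i<gap_rank P. \<bar>real_of_int (n i)\<bar> \<le> dims P i}"
proof -
  have "\<exists>m\<in>coeffs P. gap_elem G P n = gap_elem G P m"
    if "\<forall>i<gap_rank P. \<bar>real_of_int (n i)\<bar> \<le> dims P i" for n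
  proof -
    have "gap_elem G P n = gap_elem G P (restrict n {..<gap_rank P})"
      by (rule gap_elem_cong[OF assms]) simp
    moreover have "restrict n {..<gap_rank P} \<in> coeffs P"
      using that by (auto simp: coeffs_def)
    ultimately show ?thesis by blast
  qed
  then show ?thesis
    by (fastforce simp: gap_image_def coeffs_def PiE_iff)
qed

lemma dilate_simps [simp]:
  "gap_rank (dilate t P) = gap_rank P" "steps (dilate t P) = steps P"
  "dims (dilate t P) i = t * dims P i" "gap_elem G (dilate t P) = gap_elem G P"
  "dilate s (dilate t P) = dilate (s * t) P"
  by (auto simp: dilate_def gap_elem_def[abs_def] mult.assoc)

lemma sym_gap_dilate: "sym_gap G P \<Longrightarrow> 0 < t \<Longrightarrow> sym_gap G (dilate t P)"
  by (auto simp: sym_gap_def)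

lemma gap_elem_closed:
  assumes "comm_group G" "sym_gap G P"
  shows "gap_elem G P n \<in> carrier G"
proof -
  interpret comm_group G by fact
  show ?thesis
    unfolding gap_elem_def using assms(2) by (intro finprod_closed) (auto simp: sym_gap_def)
qed

lemma gap_elem_add:
  assumes "comm_group G" "sym_gap G P"
  shows "gap_elem G P (\<lambda>i. m i + n i) = gap_elem G P m \<otimes>\<^bsub>G\<^esub> gap_elem G P n"
proof -
  interpret comm_group G by fact
  have st: "steps P i \<in> carrier G" if "i < gap_rank P" for i
    using assms(2) that by (auto simp: sym_gap_def)
  have "gap_elem G P (\<lambda>i. m i + n i) =
      (\<Otimes>\<^bsub>G\<^esub>i\<in>{..<gap_rank P}. steps P i [^]\<^bsub>G\<^esub> m i \<otimes>\<^bsub>G\<^esub> steps P i [^]\<^bsub>G\<^esub> n i)"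
    unfolding gap_elem_def using st
    by (intro finprod_cong') (auto simp: int_pow_mult)
  then show ?thesis
    unfolding gap_elem_def using st by (simp add: finprod_multf Pi_iff)
qed

text \<open>The difference of two colliding coefficient functions is a relation in the doubled box.
  Members of \<open>coeffs\<close> are extensional, so distinct ones differ at an index below the
  rank.\<close>

lemma not_properE:
  assumes G: "comm_group G" and P: "sym_gap G P" and "\<not> proper G P"
  obtains n i where "i < gap_rank P" "n i \<noteq> 0" "gap_elem G P n = \<one>\<^bsub>G\<^esub>"
    "\<And>i. i < gap_rank P \<Longrightarrow> \<bar>real_of_int (n i)\<bar> \<le> 2 * dims P i"
proof -
  interpret comm_group G by fact
  obtain a b where ab: "a \<in> coeffs P" "b \<in> coeffs P" "a \<noteq> b" "gap_elem G P a = gap_elem G P b"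
    using assms(3) by (auto simp: proper_def inj_on_def)
  obtain i where i: "i < gap_rank P" "a i \<noteq> b i"
    using ab(1-3) unfolding coeffs_def by (metis PiE_ext lessThan_iff)
  define n where "n i = a i - b i" for i
  have "a = (\<lambda>i. n i + b i)" by (simp add: n_def)
  then have "gap_elem G P a = gap_elem G P n \<otimes>\<^bsub>G\<^esub> gap_elem G P b"
    using gap_elem_add[OF G P] by metis
  moreover have "gap_elem G P n \<in> carrier G" "gap_elem G P b \<in> carrier G"
    by (rule gap_elem_closed[OF G P])+
  ultimately have "gap_elem G P n = \<one>\<^bsub>G\<^esub>"
    using ab(4) by (metis r_cancel_one)
  moreover have "\<bar>real_of_int (n j)\<bar> \<le> 2 * dims P j" if "j < gap_rank P" for j
  proof -
    have "\<bar>real_of_int (a j)\<bar> \<le> dims P j" "\<bar>real_of_int (b j)\<bar> \<le> dims P j"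
      using ab(1,2) that by (auto simp: coeffs_def)
    then show ?thesis by (simp add: n_def)
  qed
  ultimately show thesis
    using i by (intro that[of i n]) (auto simp: n_def)
qed

text \<open>With \<open>A = 2 ^ r * fact r\<close>, projecting away a relation costs
  \<open>r * A\<close> in the dilation, and
  \<open>2 ^ (r - 1) * fact r + r * A \<le> 2 ^ r * fact (Suc r)\<close> closes the induction. The
  cost of lifting is proportional to \<open>t\<close>, so the second inclusion is stated for
  \<open>s \<ge> t\<close>.\<close>

lemma ex_proper_gap:
  fixes L :: "'b::real_inner set"
  assumes "comm_group G" "torsion_free G" "0 < t"
    and "discrete_subgroup L" "rank_le L r" "additive_map G L \<phi>"
  shows "\<exists>Q. gap_rank Q \<le> r \<and> sym_gap G Q \<and> t_proper G t Q \<and>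
           (\<forall>s>0. \<phi> ` {x\<in>L. norm x \<le> s} \<subseteq> gap_image G (dilate s Q)) \<and>
           (\<forall>s\<ge>t. gap_image G (dilate s Q) \<subseteq> \<phi> ` {x\<in>L. norm x \<le> 2 ^ r * fact (Suc r) * s})"
  using assms(4-)
proof (induction r arbitrary: L \<phi> rule: less_induct)
  case (less r)
  note G = assms(1,2) and t = assms(3)
  note L = less.prems(1) and rk = less.prems(2) and \<phi> = less.prems(3)
  note simps = additive_map_simps[OF G(1) L \<phi>]
  interpret comm_group G by fact
  define A where "A = (2 ^ r * fact r :: real)"
  have A: "1 \<le> A" unfolding A_def
    using mult_mono[of "1::real" "2 ^ r" 1 "fact r"] by simp
  obtain n w where n: "n \<le> r" and red: "reduced_basis L A n w"
    using ex_reduced_basis[OF L rk] by (auto simp: A_def)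
  from red have wL: "\<And>i. i < n \<Longrightarrow> w i \<in> L" "\<And>i. i < n \<Longrightarrow> w i \<noteq> 0"
    and gen: "\<And>y. y \<in> L \<Longrightarrow> \<exists>c::nat \<Rightarrow> int. y = (\<Sum>i<n. of_int (c i) *\<^sub>R w i)"
    and wA: "\<And>(c::nat \<Rightarrow> int) i. i < n \<Longrightarrow> \<bar>of_int (c i)\<bar> * norm (w i) \<le> A * norm (\<Sum>j<n. of_int (c j) *\<^sub>R w j)"
    unfolding reduced_basis_def by blast+
  define lin where "lin c = (\<Sum>i<n. of_int (c i) *\<^sub>R w i)" for c :: "nat \<Rightarrow> int"
  have linL: "lin c \<in> L" for c
    unfolding lin_def by (intro discrete_subgroup_closed[OF L] wL) auto
  \<comment> \<open>The dimension \<open>A / norm (w i)\<close> is what the coefficient bound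
    \<open>wA\<close> allows for vectors of norm at most 1, so the first inclusion holds at every
    scale.\<close>
  define Q where "Q = GAP (\<lambda>i. A / norm (w i)) (\<lambda>i. \<phi> (w i)) n"
  have rQ [simp]: "gap_rank Q = n" and dQ [simp]: "dims Q i = A / norm (w i)" for i
    by (simp_all add: Q_def)
  have symQ: "sym_gap G Q"
    using wL A additive_mapD(1)[OF \<phi>] by (auto simp: sym_gap_def Q_def)
  have elemQ: "gap_elem G Q c = \<phi> (lin c)" for c
    unfolding gap_elem_def lin_def using wL additive_mapD(1)[OF \<phi>] discrete_subgroup_closed(3)[OF L]
    by (simp add: Q_def simps(5)) (intro finprod_cong', auto simp: simps(4))
  have bound: "norm (lin c) \<le> s * (real r * A)" if "0 \<le> s" "\<And>i. i < n \<Longrightarrow> \<bar>of_int (c i)\<bar> \<le> s * (A / norm (w i))" for c s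
  proof -
    have "norm (lin c) \<le> (\<Sum>i<n. s * A)"
      unfolding lin_def
    proof (intro sum_norm_le)
      fix i assume "i \<in> {..<n}"
      then show "norm (of_int (c i) *\<^sub>R w i) \<le> s * A"
        using that(2)[of i] wL(2)[of i] by (simp add: field_simps)
    qed
    also have "\<dots> = real n * (s * A)" by simp
    also have "\<dots> \<le> real r * (s * A)"
      using n A that(1) by (intro mult_right_mono) auto
    finally show ?thesis by (simp add: algebra_simps)
  qed
  have imgQ: "gap_image G (dilate s Q) = {\<phi> (lin c) | c. \<forall>i<n. \<bar>of_int (c i)\<bar> \<le> s * (A / norm (w i))}" if "0 < s" for s
    by (subst gap_image_eq[OF G(1) sym_gap_dilate[OF symQ that]]) (simp add: elemQ)
  show ?case
  proof (cases "t_proper G t Q")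
    case True
    have "\<phi> ` {x\<in>L. norm x \<le> s} \<subseteq> gap_image G (dilate s Q)" if "0 < s" for s
    proof clarify
      fix x assume x: "x \<in> L" "norm x \<le> s"
      obtain c where c: "x = lin c" using gen[OF x(1)] by (auto simp: lin_def)
      have "\<bar>of_int (c i)\<bar> \<le> s * (A / norm (w i))" if "i < n" for i
      proof -
        have "\<bar>of_int (c i)\<bar> * norm (w i) \<le> A * norm x"
          using wA[OF that, of c] c by (simp add: lin_def)
        also have "\<dots> \<le> A * s" using x(2) A by simp
        finally show ?thesis using wL(2)[OF that] by (simp add: field_simps)
      qed
      then show "\<phi> x \<in> gap_image G (dilate s Q)"
        unfolding imgQ[OF \<open>0 < s\<close>] c by blast
    qed
    moreover have "gap_image G (dilate s Q) \<subseteq> \<phi> ` {x\<in>L. norm x \<le> 2 ^ r * fact (Suc r) * s}" if "t \<le> s" for s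
    proof -
      have s: "0 < s" using t that by simp
      have "s * (real r * A) \<le> 2 ^ r * fact (Suc r) * s"
        using s A by (simp add: A_def algebra_simps)
      then have "norm (lin c) \<le> 2 ^ r * fact (Suc r) * s"
        if "\<forall>i<n. \<bar>of_int (c i)\<bar> \<le> s * (A / norm (w i))" for c
        using bound[where c = c and s = s] s that by (meson less_imp_le order_trans)
      then show ?thesis
        unfolding imgQ[OF s] using linL by blast
    qed
    ultimately show ?thesis
      using True n symQ by (intro exI[of _ Q]) auto
  next
    case False
    then have "\<not> proper G (dilate t Q)" by (simp add: t_proper_def)
    from not_properE[OF G(1) sym_gap_dilate[OF symQ t] this, unfolded dilate_simps rQ dQ elemQ]
    obtain c i where c: "i < n" "c i \<noteq> 0" "\<phi> (lin c) = \<one>\<^bsub>G\<^esub>"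
      "\<And>i. i < n \<Longrightarrow> \<bar>real_of_int (c i)\<bar> \<le> 2 * (t * (A / norm (w i)))"
      by metis
    define x where "x = lin c"
    \<comment> \<open>The coefficient bound doubles as linear independence: a nonzero coefficient
      forces a nonzero vector.\<close>
    have "0 < \<bar>of_int (c i)\<bar> * norm (w i)" using c(1,2) wL(2) by simp
    also have "\<dots> \<le> A * norm x" using wA[OF c(1)] by (simp add: x_def lin_def)
    finally have x0: "x \<noteq> 0" by auto
    have xL: "x \<in> L" and \<phi>x: "\<phi> x = \<one>\<^bsub>G\<^esub>" using linL c(3) by (simp_all add: x_def)
    \<comment> \<open>The factor 2 stems from subtracting two coefficient functions; the lift below
      costs only half of \<open>norm x\<close> and removes it again.\<close>
    have nx: "norm x \<le> 2 * t * (real r * A)"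
      unfolding x_def using c(4) t by (intro bound) (auto simp: mult.assoc)
    have rk': "0 < r" "rank_le (proj x ` L) (r - 1)"
      using rank_le_proj[OF rk xL x0] by auto
    obtain \<psi> where \<psi>: "additive_map G (proj x ` L) \<psi>" "\<And>y. y \<in> L \<Longrightarrow> \<psi> (proj x y) = \<phi> y"
      using ex_additive_map_proj[OF G L \<phi> xL \<phi>x] by blast
    obtain Q' where Q': "gap_rank Q' \<le> r - 1" "sym_gap G Q'" "t_proper G t Q'"
      "\<And>s. 0 < s \<Longrightarrow> \<psi> ` {y \<in> proj x ` L. norm y \<le> s} \<subseteq> gap_image G (dilate s Q')"
      "\<And>s. t \<le> s \<Longrightarrow> gap_image G (dilate s Q') \<subseteq> \<psi> ` {y \<in> proj x ` L. norm y \<le> 2 ^ (r - 1) * fact (Suc (r - 1)) * s}"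
      using less.IH[OF _ discrete_subgroup_proj[OF L xL x0] rk'(2) \<psi>(1)] rk'(1) by auto
    have "\<phi> ` {y\<in>L. norm y \<le> s} \<subseteq> gap_image G (dilate s Q')" if "0 < s" for s
    proof clarify
      fix y assume y: "y \<in> L" "norm y \<le> s"
      then have "proj x y \<in> {y \<in> proj x ` L. norm y \<le> s}"
        using norm_proj_le[of x y] by auto
      then show "\<phi> y \<in> gap_image G (dilate s Q')"
        using Q'(4)[OF that] \<psi>(2)[OF y(1)] by (metis (no_types, lifting) image_eqI subsetD)
    qed
    moreover have "gap_image G (dilate s Q') \<subseteq> \<phi> ` {x\<in>L. norm x \<le> 2 ^ r * fact (Suc r) * s}" if ts: "t \<le> s" for s
    proof
      fix g assume "g \<in> gap_image G (dilate s Q')"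
      then obtain y where y: "y \<in> L" "norm (proj x y) \<le> 2 ^ (r - 1) * fact (Suc (r - 1)) * s" "g = \<phi> y"
        using Q'(5)[OF ts] \<psi>(2) by auto
      obtain k :: int where k: "norm (y + of_int k *\<^sub>R x) \<le> norm (proj x y) + norm x / 2"
        using ex_short_lift_norm[OF x0] by blast
      define z where "z = y + of_int k *\<^sub>R x"
      have zL: "z \<in> L" unfolding z_def using y(1) xL discrete_subgroup_closed[OF L] by blast
      \<comment> \<open>Both values are read off the same projected vector through
        \<open>\<psi>\<close>.\<close>
      have "\<phi> z = \<phi> y"
        using \<psi>(2)[OF zL] \<psi>(2)[OF y(1)] by (simp add: z_def proj_add_scaleR)
      moreover have "norm z \<le> 2 ^ r * fact (Suc r) * s"
      proof -
        have "norm z \<le> 2 ^ (r - 1) * fact (Suc (r - 1)) * s + t * (real r * A)"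
          using k y(2) nx by (simp add: z_def)
        also have "2 ^ (r - 1) * fact (Suc (r - 1)) * s \<le> A * s"
          using rk'(1) t ts by (cases r) (auto simp: A_def)
        also have "t * (real r * A) \<le> s * (real r * A)"
          using ts A by (intro mult_right_mono) auto
        also have "A * s + s * (real r * A) = 2 ^ r * fact (Suc r) * s"
          by (simp add: A_def algebra_simps)
        finally show ?thesis by simp
      qed
      ultimately show "g \<in> \<phi> ` {x\<in>L. norm x \<le> 2 ^ r * fact (Suc r) * s}"
        using zL y(3) by (metis (mono_tags, lifting) image_eqI mem_Collect_eq)
    qed
    ultimately show ?thesis
      using Q'(1-3) rk'(1) by (intro exI[of _ Q']) auto
  qed
qed

subsection \<open>Finitely supported vectors and the lattice of a GAP\<close>

text \<open>
  The rank varies inside the statement, so the lattices of all ranks live in one inner product space.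
\<close>

typedef fvec = "{f :: nat \<Rightarrow> real. finite {i. f i \<noteq> 0}}"
  morphisms coord Abs_fvec
  by (rule exI[of _ "\<lambda>_. 0"]) simp

setup_lifting type_definition_fvec

lemma finite_support: "finite {i. coord x i \<noteq> 0}"
  using coord[of x] by simp

instantiation fvec :: real_vector
begin

lift_definition zero_fvec :: fvec is "\<lambda>_. 0" by simp

lift_definition plus_fvec :: "fvec \<Rightarrow> fvec \<Rightarrow> fvec" is "\<lambda>f g i. f i + g i"
  subgoal for f g by (rule finite_subset[of _ "{i. f i \<noteq> 0} \<union> {i. g i \<noteq> 0}"]) auto
  done

lift_definition minus_fvec :: "fvec \<Rightarrow> fvec \<Rightarrow> fvec" is "\<lambda>f g i. f i - g i"
  subgoal for f g by (rule finite_subset[of _ "{i. f i \<noteq> 0} \<union> {i. g i \<noteq> 0}"]) auto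
  done

lift_definition uminus_fvec :: "fvec \<Rightarrow> fvec" is "\<lambda>f i. - f i" by simp

lift_definition scaleR_fvec :: "real \<Rightarrow> fvec \<Rightarrow> fvec" is "\<lambda>r f i. r * f i"
  by (rule finite_subset) auto

instance
  by standard (transfer; simp add: algebra_simps)+

end

lemma coord_simps [simp]:
  "coord 0 i = 0" "coord (x + y) i = coord x i + coord y i" "coord (x - y) i = coord x i - coord y i"
  "coord (- x) i = - coord x i" "coord (r *\<^sub>R x) i = r * coord x i"
  by (transfer; simp)+

lemma coord_sum [simp]: "coord (\<Sum>j\<in>A. f j) i = (\<Sum>j\<in>A. coord (f j) i)"
  by (induction A rule: infinite_finite_induct) auto

lemma fvec_eqI: "(\<And>i. coord x i = coord y i) \<Longrightarrow> x = y"
  by (simp add: coord_inject[symmetric] ext)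

text \<open>Summing over the support of the first argument keeps the sum finite;
  \<open>fvec_inner_eq\<close> allows any larger finite range, which restores symmetry.\<close>

definition fvec_inner :: "fvec \<Rightarrow> fvec \<Rightarrow> real" where
  "fvec_inner x y = (\<Sum>i | coord x i \<noteq> 0. coord x i * coord y i)"

lemma fvec_inner_eq:
  assumes "finite A" "{i. coord x i \<noteq> 0} \<subseteq> A"
  shows "fvec_inner x y = (\<Sum>i\<in>A. coord x i * coord y i)"
  unfolding fvec_inner_def using assms by (intro sum.mono_neutral_left) auto

instantiation fvec :: real_inner
begin

definition inner_fvec :: "fvec \<Rightarrow> fvec \<Rightarrow> real" where
  "inner_fvec = fvec_inner"

definition norm_fvec :: "fvec \<Rightarrow> real" where
  "norm_fvec x = sqrt (inner x x)"

definition dist_fvec :: "fvec \<Rightarrow> fvec \<Rightarrow> real" where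
  "dist_fvec x y = norm (x - y)"

definition sgn_fvec :: "fvec \<Rightarrow> fvec" where
  "sgn_fvec x = inverse (norm x) *\<^sub>R x"

definition uniformity_fvec :: "(fvec \<times> fvec) filter" where
  "uniformity_fvec = (INF e\<in>{0<..}. principal {(x, y). dist x y < e})"

definition open_fvec :: "fvec set \<Rightarrow> bool" where
  "open_fvec U \<longleftrightarrow> (\<forall>x\<in>U. \<forall>\<^sub>F (x', y) in uniformity. x' = x \<longrightarrow> y \<in> U)"

instance
proof
  fix x y z :: fvec and r :: real
  \<comment> \<open>A common finite range, so that all inner products below become sums over the
    same set.\<close>
  define A where "A = {i. coord x i \<noteq> 0} \<union> {i. coord y i \<noteq> 0}"
  have A: "finite A" by (simp add: A_def finite_support)
  have sub: "{i. coord x i \<noteq> 0} \<subseteq> A" "{i. coord y i \<noteq> 0} \<subseteq> A" "{i. coord (x + y) i \<noteq> 0} \<subseteq> A"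
    "{i. coord (r *\<^sub>R x) i \<noteq> 0} \<subseteq> A"
    by (auto simp: A_def)
  have eq: "inner u v = (\<Sum>i\<in>A. coord u i * coord v i)" if "{i. coord u i \<noteq> 0} \<subseteq> A" for u v
    unfolding inner_fvec_def using fvec_inner_eq[OF A that] .
  show "dist x y = norm (x - y)" by (rule dist_fvec_def)
  show "sgn x = x /\<^sub>R norm x" by (rule sgn_fvec_def)
  show "uniformity = (INF e\<in>{0<..}. principal {(x, y::fvec). dist x y < e})"
    by (rule uniformity_fvec_def)
  show "open U \<longleftrightarrow> (\<forall>x\<in>U. \<forall>\<^sub>F (x', y) in uniformity. x' = x \<longrightarrow> y \<in> U)" for U :: "fvec set"
    by (rule open_fvec_def)
  show "inner x y = inner y x"
    using eq[OF sub(1)] eq[OF sub(2)] by (simp add: mult.commute)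
  show "inner (x + y) z = inner x z + inner y z"
    using eq[OF sub(1)] eq[OF sub(2)] eq[OF sub(3)] by (simp add: sum.distrib distrib_right)
  show "inner (r *\<^sub>R x) y = r * inner x y"
    using eq[OF sub(1)] eq[OF sub(4)] by (simp add: sum_distrib_left mult.assoc)
  show "0 \<le> inner x x"
    using eq[OF sub(1)] by (simp add: sum_nonneg)
  show "inner x x = 0 \<longleftrightarrow> x = 0"
  proof
    assume "inner x x = 0"
    then have "\<forall>i\<in>A. coord x i * coord x i = 0"
      using A eq[OF sub(1), of x] sum_nonneg_eq_0_iff[OF A, of "\<lambda>i. coord x i * coord x i"] by simp
    then show "x = 0" using sub(1) by (intro fvec_eqI) auto
  qed (use eq[OF sub(1), of x] in simp)
  show "norm x = sqrt (inner x x)" by (rule norm_fvec_def)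
qed

end

section \<open>The lattice attached to a GAP\<close>

definition box_vec :: "'a gap \<Rightarrow> (nat \<Rightarrow> int) \<Rightarrow> fvec" where
  "box_vec P n = Abs_fvec (\<lambda>i. if i < gap_rank P then of_int (n i) / dims P i else 0)"

lemma coord_box_vec: "coord (box_vec P n) i = (if i < gap_rank P then of_int (n i) / dims P i else 0)"
  unfolding box_vec_def
  by (subst Abs_fvec_inverse) (auto intro!: finite_subset[of _ "{..<gap_rank P}"])

lemma norm_box_vec: "norm (box_vec P n) = sqrt (\<Sum>i<gap_rank P. (of_int (n i) / dims P i)\<^sup>2)"
proof -
  have "{i. coord (box_vec P n) i \<noteq> 0} \<subseteq> {..<gap_rank P}"
    by (auto simp: coord_box_vec split: if_splits)
  then have "inner (box_vec P n) (box_vec P n) = (\<Sum>i<gap_rank P. (of_int (n i) / dims P i)\<^sup>2)"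
    unfolding inner_fvec_def by (subst fvec_inner_eq) (auto simp: coord_box_vec power2_eq_square)
  then show ?thesis by (simp add: norm_eq_sqrt_inner)
qed

text \<open>Cube inside ball: each of the coordinates contributes at most \<open>s\<^sup>2\<close>
  to the squared norm. This is the source of the factors \<open>sqrt d\<close> below.\<close>

lemma norm_box_vec_le:
  assumes "sym_gap G P" "0 \<le> s" "\<And>i. i < gap_rank P \<Longrightarrow> \<bar>of_int (n i)\<bar> \<le> s * dims P i"
  shows "norm (box_vec P n) \<le> sqrt (gap_rank P) * s"
proof -
  have "(\<Sum>i<gap_rank P. (of_int (n i) / dims P i)\<^sup>2) \<le> (\<Sum>i<gap_rank P. s\<^sup>2)"
  proof (intro sum_mono)
    fix i assume i: "i \<in> {..<gap_rank P}"
    then have "\<bar>of_int (n i) / dims P i\<bar> \<le> \<bar>s\<bar>"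
      using assms by (auto simp: sym_gap_def abs_divide divide_le_eq)
    then show "(of_int (n i) / dims P i)\<^sup>2 \<le> s\<^sup>2" by (simp only: abs_le_square_iff)
  qed
  also have "\<dots> = (sqrt (gap_rank P) * s)\<^sup>2" by (simp add: power_mult_distrib)
  finally show ?thesis
    unfolding norm_box_vec using assms(2) by (intro real_le_lsqrt) (auto intro: sum_nonneg)
qed

text \<open>Ball inside cube, without loss: no single coordinate exceeds the norm.\<close>

lemma coeff_le_norm_box_vec:
  assumes "sym_gap G P" "i < gap_rank P"
  shows "\<bar>of_int (n i)\<bar> \<le> norm (box_vec P n) * dims P i"
proof -
  have "(of_int (n i) / dims P i)\<^sup>2 \<le> (\<Sum>i<gap_rank P. (of_int (n i) / dims P i)\<^sup>2)"
    using assms(2) by (intro member_le_sum) auto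
  then have "\<bar>of_int (n i) / dims P i\<bar> \<le> norm (box_vec P n)"
    unfolding norm_box_vec by (intro real_le_rsqrt) (simp only: power2_abs)
  then show ?thesis
    using assms by (auto simp: sym_gap_def abs_divide divide_le_eq)
qed

lemma finite_coeffs: "finite (coeffs P)"
proof -
  have "finite {k. \<bar>real_of_int k\<bar> \<le> c}" for c
  proof (rule finite_subset)
    show "{k. \<bar>real_of_int k\<bar> \<le> c} \<subseteq> {- \<lceil>c\<rceil>..\<lceil>c\<rceil>}" by (auto; linarith)
  qed simp
  then show ?thesis by (auto simp: coeffs_def intro: finite_PiE)
qed

text \<open>A bound on the norm bounds every coefficient. As \<open>box_vec\<close> sees only
  indices below the rank, \<open>restrict\<close> moves the coefficients into a finite set without
  changing the vector.\<close>

lemma discrete_subgroup_box_vec: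
  assumes P: "sym_gap G P"
  shows "discrete_subgroup (range (box_vec P))"
  unfolding discrete_subgroup_def
proof (intro conjI ballI allI)
  have "box_vec P (\<lambda>_. 0) = 0" by (rule fvec_eqI) (simp add: coord_box_vec)
  then show "0 \<in> range (box_vec P)" by (metis rangeI)
  have "box_vec P m - box_vec P n = box_vec P (\<lambda>i. m i - n i)" for m n
    by (rule fvec_eqI) (simp add: coord_box_vec diff_divide_distrib)
  then show "x - y \<in> range (box_vec P)" if "x \<in> range (box_vec P)" "y \<in> range (box_vec P)" for x y
    using that by auto
  fix R
  have "{x \<in> range (box_vec P). norm x \<le> R} \<subseteq>
      box_vec P ` (\<Pi>\<^sub>E i\<in>{..<gap_rank P}. {k. \<bar>real_of_int k\<bar> \<le> R * dims P i})"
  proof clarify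
    fix n assume n: "norm (box_vec P n) \<le> R"
    have "\<bar>of_int (n i)\<bar> \<le> R * dims P i" if "i < gap_rank P" for i
    proof -
      have "norm (box_vec P n) * dims P i \<le> R * dims P i"
        using n P that by (intro mult_right_mono) (auto simp: sym_gap_def less_imp_le)
      then show ?thesis using coeff_le_norm_box_vec[OF P that, of n] by linarith
    qed
    then show "box_vec P n \<in> box_vec P ` (\<Pi>\<^sub>E i\<in>{..<gap_rank P}. {k. \<bar>real_of_int k\<bar> \<le> R * dims P i})"
      by (intro image_eqI[of _ _ "restrict n {..<gap_rank P}"] fvec_eqI) (auto simp: coord_box_vec)
  qed
  then show "finite {x \<in> range (box_vec P). norm x \<le> R}"
    using finite_coeffs[of "dilate R P"] unfolding coeffs_def dilate_simps
    by (meson finite_imageI finite_subset)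
qed

lemma rank_le_box_vec:
  "rank_le (range (box_vec P)) (gap_rank P)"
proof -
  define e where "e j = Abs_fvec (\<lambda>i. if i = j then 1 else 0)" for j :: nat
  have e: "coord (e j) i = (if i = j then 1 else 0)" for i j
    unfolding e_def by (subst Abs_fvec_inverse) auto
  have "box_vec P n = (\<Sum>j<gap_rank P. (of_int (n j) / dims P j) *\<^sub>R e j)" for n
    by (rule fvec_eqI) (simp add: coord_box_vec e sum.delta' if_distrib cong: if_cong)
  then have "box_vec P n \<in> span (e ` {..<gap_rank P})" for n
    by (simp only:) (intro span_sum span_scale span_base imageI)
  then have "range (box_vec P) \<subseteq> span (e ` {..<gap_rank P})"
    by blast
  moreover have "card (e ` {..<gap_rank P}) \<le> gap_rank P"
    by (metis card_image_le card_lessThan finite_lessThan)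
  ultimately show ?thesis
    unfolding rank_le_def by (intro exI[of _ "e ` {..<gap_rank P}"]) auto
qed

text \<open>On the lattice, multiplying back by the dimensions recovers the integer coefficients;
  \<open>round\<close> extends this to a function on all of \<open>fvec\<close>.\<close>

definition box_map :: "('a, 'm) monoid_scheme \<Rightarrow> 'a gap \<Rightarrow> fvec \<Rightarrow> 'a" where
  "box_map G P x = gap_elem G P (\<lambda>i. round (coord x i * dims P i))"

lemma box_map_box_vec:
  assumes "comm_group G" "sym_gap G P"
  shows "box_map G P (box_vec P n) = gap_elem G P n"
  unfolding box_map_def using assms
  by (intro gap_elem_cong) (auto simp: coord_box_vec sym_gap_def)

lemma additive_map_box_map:
  assumes "comm_group G" "sym_gap G P"
  shows "additive_map G (range (box_vec P)) (box_map G P)"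
proof -
  have "box_vec P m + box_vec P n = box_vec P (\<lambda>i. m i + n i)" for m n
    by (rule fvec_eqI) (simp add: coord_box_vec add_divide_distrib)
  then show ?thesis
    using assms
    by (auto simp: additive_map_def box_map_box_vec gap_elem_add gap_elem_closed)
qed

text \<open>A relation in \<open>P\<close> itself is projected away first, which guarantees the drop
  in rank; \<open>ex_proper_gap\<close> then handles the projected lattice. The summand
  \<open>2 ^ (d - 1) * fact d\<close> is the loss there, and \<open>D\<close> is the cost of lifting
  along the relation.\<close>

lemma ex_lower_rank_container:
  assumes G: "comm_group G" "torsion_free G" and P: "sym_gap G P"
    and t: "0 < t" and D: "0 < D" and np: "\<not> proper G (dilate (D * t) P)"
  defines "d \<equiv> gap_rank P"
  shows "\<exists>Q. gap_rank Q < d \<and> sym_gap G Q \<and> t_proper G t Q \<and>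
           (\<forall>s>0. gap_image G (dilate s P) \<subseteq> gap_image G (dilate s Q)) \<and>
           (\<forall>s\<ge>t. gap_image G (dilate s Q) \<subseteq> gap_image G (dilate (sqrt d * (2 ^ (d - 1) * fact d + D) * s) P))"
proof -
  define L where "L = range (box_vec P)"
  define \<phi> where "\<phi> = box_map G P"
  have L: "discrete_subgroup L" and rk: "rank_le L d" and \<phi>: "additive_map G L \<phi>"
    unfolding L_def \<phi>_def d_def
    using discrete_subgroup_box_vec[OF P] rank_le_box_vec additive_map_box_map[OF G(1) P] by auto
  have \<phi>_box: "\<phi> (box_vec P n) = gap_elem G P n" for n
    unfolding \<phi>_def by (rule box_map_box_vec[OF G(1) P])
  have imgP: "gap_image G (dilate s P) = {gap_elem G P n | n. \<forall>i<d. \<bar>of_int (n i)\<bar> \<le> s * dims P i}" if "0 < s" for s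
    by (subst gap_image_eq[OF G(1) sym_gap_dilate[OF P that]]) (simp add: d_def)
  from not_properE[OF G(1) sym_gap_dilate[OF P mult_pos_pos[OF D t]] np, unfolded dilate_simps]
  obtain n i where n: "i < d" "n i \<noteq> 0" "gap_elem G P n = \<one>\<^bsub>G\<^esub>"
    "\<And>i. i < d \<Longrightarrow> \<bar>real_of_int (n i)\<bar> \<le> 2 * (D * t * dims P i)"
    unfolding d_def by metis
  define x where "x = box_vec P n"
  have "coord x i \<noteq> 0" using n(1,2) P by (auto simp: x_def coord_box_vec sym_gap_def d_def)
  then have x0: "x \<noteq> 0" by auto
  have xL: "x \<in> L" and \<phi>x: "\<phi> x = \<one>\<^bsub>G\<^esub>" using n(3) by (auto simp: x_def L_def \<phi>_box)
  have nx: "norm x \<le> sqrt d * (2 * (D * t))"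
    unfolding x_def d_def using n(4) D t by (intro norm_box_vec_le[OF P]) (auto simp: d_def mult.assoc)
  have rk': "0 < d" "rank_le (proj x ` L) (d - 1)"
    using rank_le_proj[OF rk xL x0] by auto
  have sq: "0 < sqrt d" using rk'(1) by simp
  obtain \<psi> where \<psi>: "additive_map G (proj x ` L) \<psi>" "\<And>y. y \<in> L \<Longrightarrow> \<psi> (proj x y) = \<phi> y"
    using ex_additive_map_proj[OF G L \<phi> xL \<phi>x] by blast
  obtain Q where Q: "gap_rank Q \<le> d - 1" "sym_gap G Q" "t_proper G (sqrt d * t) Q"
    "\<And>s. 0 < s \<Longrightarrow> \<psi> ` {y \<in> proj x ` L. norm y \<le> s} \<subseteq> gap_image G (dilate s Q)"
    "\<And>s. sqrt d * t \<le> s \<Longrightarrow> gap_image G (dilate s Q) \<subseteq> \<psi> ` {y \<in> proj x ` L. norm y \<le> 2 ^ (d - 1) * fact (Suc (d - 1)) * s}"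
    using ex_proper_gap[OF G mult_pos_pos[OF sq t] discrete_subgroup_proj[OF L xL x0] rk'(2) \<psi>(1)] by auto
  \<comment> \<open>Passing from the box of \<open>P\<close> to a ball enlarges it by
    \<open>sqrt d\<close>, which this dilation absorbs. Since \<open>Q\<close> is proper at
    \<open>sqrt d * t\<close>, the dilate is proper at \<open>t\<close>.\<close>
  define Q' where "Q' = dilate (sqrt d) Q"
  have "gap_image G (dilate s P) \<subseteq> gap_image G (dilate s Q')" if s: "0 < s" for s
  proof
    fix g assume "g \<in> gap_image G (dilate s P)"
    then obtain m where m: "g = gap_elem G P m" "\<forall>i<d. \<bar>of_int (m i)\<bar> \<le> s * dims P i"
      unfolding imgP[OF s] by blast
    have "norm (box_vec P m) \<le> sqrt d * s"
      using norm_box_vec_le[OF P, of s m] m(2) s by (simp add: d_def)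
    then have "proj x (box_vec P m) \<in> {y \<in> proj x ` L. norm y \<le> s * sqrt d}"
      using norm_proj_le[of x "box_vec P m"] by (auto simp: L_def mult.commute)
    moreover have "\<psi> (proj x (box_vec P m)) = g"
      using \<psi>(2)[of "box_vec P m"] m(1) by (simp add: L_def \<phi>_box)
    ultimately show "g \<in> gap_image G (dilate s Q')"
      using Q(4)[OF mult_pos_pos[OF s sq]] unfolding Q'_def dilate_simps
      by (metis (no_types, lifting) image_eqI subsetD)
  qed
  moreover have "gap_image G (dilate s Q') \<subseteq> gap_image G (dilate (sqrt d * (2 ^ (d - 1) * fact d + D) * s) P)"
    if ts: "t \<le> s" for s
  proof
    fix g assume "g \<in> gap_image G (dilate s Q')"
    moreover have "sqrt d * t \<le> s * sqrt d" using ts sq by simp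
    ultimately obtain y where y: "y \<in> L" "norm (proj x y) \<le> 2 ^ (d - 1) * fact d * (s * sqrt d)" "g = \<phi> y"
      using Q(5)[of "s * sqrt d"] \<psi>(2) rk'(1) unfolding Q'_def dilate_simps by auto
    obtain k :: int where k: "norm (y + of_int k *\<^sub>R x) \<le> norm (proj x y) + norm x / 2"
      using ex_short_lift_norm[OF x0] by blast
    define z where "z = y + of_int k *\<^sub>R x"
    have zL: "z \<in> L" unfolding z_def using y(1) xL discrete_subgroup_closed[OF L] by blast
    have "\<phi> z = \<phi> y"
      using \<psi>(2)[OF zL] \<psi>(2)[OF y(1)] by (simp add: z_def proj_add_scaleR)
    obtain m where m: "z = box_vec P m" using zL by (auto simp: L_def)
    define K where "K = sqrt d * (2 ^ (d - 1) * fact d + D) * s"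
    \<comment> \<open>Half of \<open>norm x\<close> is at most \<open>sqrt d * (D * t)\<close>, and
      \<open>t \<le> s\<close> turns this fixed cost into part of the dilation.\<close>
    have "norm z \<le> 2 ^ (d - 1) * fact d * (s * sqrt d) + sqrt d * (D * t)"
      using k y(2) nx by (simp add: z_def)
    also have "sqrt d * (D * t) \<le> sqrt d * (D * s)"
      using sq D ts by simp
    also have "2 ^ (d - 1) * fact d * (s * sqrt d) + sqrt d * (D * s) = K"
      by (simp add: K_def algebra_simps)
    finally have nz: "norm (box_vec P m) \<le> K" by (simp add: m)
    have "\<bar>of_int (m i)\<bar> \<le> K * dims P i" if "i < d" for i
    proof -
      have "norm (box_vec P m) * dims P i \<le> K * dims P i"
        using nz P that by (intro mult_right_mono) (auto simp: sym_gap_def d_def less_imp_le)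
      then show ?thesis using coeff_le_norm_box_vec[OF P, of i m] that by (simp add: d_def)
    qed
    moreover have "0 < K"
      unfolding K_def using sq D t ts by (intro mult_pos_pos add_nonneg_pos) auto
    moreover have "g = gap_elem G P m"
      using \<open>\<phi> z = \<phi> y\<close> y(3) m \<phi>_box by simp
    ultimately show "g \<in> gap_image G (dilate K P)"
      using imgP by blast
  qed
  moreover have "gap_rank Q' < d" "sym_gap G Q'" "t_proper G t Q'"
    using Q(1-3) rk'(1) sym_gap_dilate[OF Q(2) sq] by (auto simp: Q'_def t_proper_def mult.commute)
  ultimately show ?thesis by blast
qed

subsection \<open>Sizes and the numerical constants\<close>

lemma finite_gap_image: "finite (gap_image G P)"
  by (simp add: gap_image_def finite_coeffs)

lemma gap_image_dilate_mono:
  assumes "sym_gap G P" "s \<le> s'"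
  shows "gap_image G (dilate s P) \<subseteq> gap_image G (dilate s' P)"
proof -
  have "s * dims P i \<le> s' * dims P i" if "i < gap_rank P" for i
    using assms that by (intro mult_right_mono) (auto simp: sym_gap_def less_imp_le)
  then have "coeffs (dilate s P) \<subseteq> coeffs (dilate s' P)"
    unfolding coeffs_def dilate_simps by (intro PiE_mono) fastforce
  then show ?thesis by (auto simp: gap_image_def)
qed

lemma gap_size_mono: "gap_image G P \<subseteq> gap_image G Q \<Longrightarrow> gap_size G P \<le> gap_size G Q"
  unfolding gap_size_def by (intro card_mono finite_gap_image)

text \<open>
  The box is cut into translates of the unit box; two elements of the same translate
  differ by an element of the image of \<open>P\<close>.
\<close>

lemma gap_size_dilate_le:
  assumes G: "comm_group G" and P: "sym_gap G P" and s: "1 \<le> s"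
  shows "real (gap_size G (dilate s P)) \<le> (4 * s) ^ gap_rank P * real (gap_size G P)"
proof -
  interpret comm_group G by fact
  define d where "d = gap_rank P"
  define \<beta> where "\<beta> n = (\<lambda>i\<in>{..<d}. \<lfloor>of_int (n i) / dims P i\<rfloor>)" for n :: "nat \<Rightarrow> int"
  define B where "B = (\<Pi>\<^sub>E i\<in>{..<d}. {\<lfloor>- s\<rfloor>..\<lfloor>s\<rfloor>})"
  define C where "C = coeffs (dilate s P)"
  \<comment> \<open>One representative per cell of the subdivision, so that finitely many translates
    indexed by \<open>B\<close> suffice.\<close>
  define rep where "rep b = (SOME n. n \<in> C \<and> \<beta> n = b)" for b
  have pos: "0 < dims P i" if "i < d" for i using P that by (auto simp: sym_gap_def d_def)
  have \<beta>B: "\<beta> n \<in> B" if "n \<in> C" for n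
  proof -
    have "- s \<le> of_int (n i) / dims P i \<and> of_int (n i) / dims P i \<le> s" if "i < d" for i
    proof -
      have "\<bar>of_int (n i)\<bar> \<le> s * dims P i"
        using \<open>n \<in> C\<close> that by (auto simp: C_def coeffs_def d_def)
      then have "\<bar>of_int (n i) / dims P i\<bar> \<le> s"
        using pos[OF that] by (simp add: abs_divide divide_le_eq)
      then show ?thesis by linarith
    qed
    then show ?thesis by (auto simp: \<beta>_def B_def intro!: floor_mono)
  qed
  have "gap_image G (dilate s P) \<subseteq> (\<Union>b\<in>B. (\<lambda>g. g \<otimes>\<^bsub>G\<^esub> gap_elem G P (rep b)) ` gap_image G P)"
  proof
    fix g assume "g \<in> gap_image G (dilate s P)"
    then obtain n where n: "n \<in> C" "g = gap_elem G P n" by (auto simp: gap_image_def C_def)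
    define m where "m = rep (\<beta> n)"
    have m: "m \<in> C \<and> \<beta> m = \<beta> n"
      unfolding m_def rep_def by (rule someI[of _ n]) (use n in auto)
    have "\<bar>of_int (n i - m i)\<bar> \<le> dims P i" if "i < d" for i
    proof -
      have "\<lfloor>of_int (n i) / dims P i\<rfloor> = \<lfloor>of_int (m i) / dims P i\<rfloor>"
        using fun_cong[OF conjunct2[OF m], of i] that by (simp add: \<beta>_def)
      then have "\<bar>of_int (n i) / dims P i - of_int (m i) / dims P i\<bar> \<le> 1" by linarith
      then have "\<bar>of_int (n i - m i) / dims P i\<bar> \<le> 1" by (simp add: diff_divide_distrib)
      then show ?thesis using pos[OF that] by (simp add: abs_divide divide_le_eq)
    qed
    then have "gap_elem G P (\<lambda>i. n i - m i) \<in> gap_image G P"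
      unfolding gap_image_eq[OF G P] d_def by blast
    moreover have "g = gap_elem G P (\<lambda>i. n i - m i) \<otimes>\<^bsub>G\<^esub> gap_elem G P m"
      by (simp add: n(2) flip: gap_elem_add[OF G P])
    ultimately show "g \<in> (\<Union>b\<in>B. (\<lambda>g. g \<otimes>\<^bsub>G\<^esub> gap_elem G P (rep b)) ` gap_image G P)"
      using \<beta>B[OF n(1)] unfolding m_def by blast
  qed
  moreover have fB: "finite B" by (auto simp: B_def intro: finite_PiE)
  ultimately have "gap_size G (dilate s P) \<le> card (\<Union>b\<in>B. (\<lambda>g. g \<otimes>\<^bsub>G\<^esub> gap_elem G P (rep b)) ` gap_image G P)"
    unfolding gap_size_def by (intro card_mono) (auto intro: finite_gap_image)
  also have "\<dots> \<le> (\<Sum>b\<in>B. card ((\<lambda>g. g \<otimes>\<^bsub>G\<^esub> gap_elem G P (rep b)) ` gap_image G P))"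
    by (rule card_UN_le[OF fB])
  also have "\<dots> \<le> (\<Sum>b\<in>B. gap_size G P)"
    unfolding gap_size_def by (intro sum_mono card_image_le finite_gap_image)
  finally have "real (gap_size G (dilate s P)) \<le> real (card B) * real (gap_size G P)"
    by (metis of_nat_le_iff of_nat_mult sum_constant of_nat_id)
  moreover have "real (card B) \<le> (4 * s) ^ d"
  proof -
    \<comment> \<open>Each coordinate has at most \<open>2 * s + 2\<close> cells, which is at most
      \<open>4 * s\<close> because \<open>s \<ge> 1\<close>.\<close>
    have "real (nat (\<lfloor>s\<rfloor> - \<lfloor>- s\<rfloor> + 1)) \<le> 4 * s"
      using s by linarith
    from power_mono[OF this, of d] show ?thesis by (simp add: B_def card_PiE)
  qed
  ultimately show ?thesis
    unfolding d_def by (meson mult_right_mono of_nat_0_le_iff order_trans)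
qed

section \<open>Powers of \<open>C * d\<close> and the choice of the constant\<close>

lemma dilate_one [simp]: "dilate 1 P = P"
  by (cases P) (simp add: dilate_def)

lemma rpow_ge_one:
  assumes "1 \<le> C"
  shows "1 \<le> rpow (C * real d) (3 * real d / 2)"
proof (cases "d = 0")
  case False
  then have "1 \<le> C * real d" using assms mult_mono[of 1 C 1 "real d"] by simp
  then show ?thesis using False by (simp add: rpow_def ge_one_powr_ge_zero)
qed (simp add: rpow_def)

text \<open>The factor in the size bound is the dilation factor once per coordinate. At
  \<open>d = 0\<close> both sides are 1.\<close>

lemma rpow_square:
  assumes "0 < C"
  shows "rpow (C * real d) (3 * (real d)\<^sup>2 / 2) = rpow (C * real d) (3 * real d / 2) ^ d"
proof (cases "d = 0")
  case False
  have "rpow (C * real d) (3 * real d / 2) ^ d = ((C * real d) powr (3 * real d / 2)) powr real d"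
    using False assms by (simp add: rpow_def powr_realpow)
  then show ?thesis
    using False by (simp add: rpow_def powr_powr power2_eq_square mult.assoc)
qed (simp add: rpow_def)

text \<open>Properness and two inclusions with one factor \<open>K\<close> give all clauses; the 4
  in \<open>4 * K\<close> pays for the count in \<open>gap_size_dilate_le\<close>.\<close>

lemma proper_containerI:
  fixes C K t :: real
  assumes G: "comm_group G" and C: "0 < C" and P: "sym_gap G P" and Q: "sym_gap G Q" "t_proper G t Q"
    and t: "1 \<le> t" and K: "1 \<le> K" "4 * K \<le> rpow (C * real (gap_rank P)) (3 * real (gap_rank P) / 2)"
    and PQ: "\<And>s. 0 < s \<Longrightarrow> gap_image G (dilate s P) \<subseteq> gap_image G (dilate s Q)"
    and QP: "\<And>s. t \<le> s \<Longrightarrow> gap_image G (dilate s Q) \<subseteq> gap_image G (dilate (K * s) P)"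
  shows "proper_container G C P t Q"
proof -
  define d where "d = gap_rank P"
  define M where "M = rpow (C * real d) (3 * real d / 2)"
  have KM: "4 * K \<le> M" using K by (simp add: M_def d_def)
  have 1: "gap_image G (dilate (t * t') Q) \<subseteq> gap_image G (dilate (M * t * t') P)" if "1 \<le> t'" for t'
  proof -
    have tt: "t \<le> t * t'" using that t by simp
    have "K * (t * t') \<le> M * (t * t')"
      using KM K t that by (intro mult_right_mono) auto
    then show ?thesis
      using QP[OF tt] gap_image_dilate_mono[OF P, of "K * (t * t')" "M * t * t'"] by (simp add: mult.assoc)
  qed
  \<comment> \<open>Only dilates by at least \<open>t\<close> are controlled from above, so
    \<open>Q\<close> is first enlarged to its dilate by \<open>t \<ge> 1\<close>.\<close>
  have "gap_image G Q \<subseteq> gap_image G (dilate (K * t) P)"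
    using gap_image_dilate_mono[OF Q(1) t] QP[of t] by simp
  then have "real (gap_size G Q) \<le> real (gap_size G (dilate (K * t) P))"
    by (simp add: gap_size_mono)
  also have "\<dots> \<le> (4 * (K * t)) ^ d * real (gap_size G P)"
    unfolding d_def using K t mult_mono[of 1 K 1 t] by (intro gap_size_dilate_le[OF G P]) simp
  also have "\<dots> = t ^ d * (4 * K) ^ d * real (gap_size G P)"
    by (simp add: power_mult_distrib algebra_simps)
  also have "\<dots> \<le> t ^ d * M ^ d * real (gap_size G P)"
    using KM K t by (intro mult_right_mono mult_left_mono power_mono) auto
  finally have 2: "real (gap_size G Q) \<le> t ^ d * M ^ d * real (gap_size G P)" .
  have 3: "gap_size G P \<le> gap_size G Q"
    using PQ[of 1] by (simp add: gap_size_mono)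
  show ?thesis
    unfolding proper_container_def Let_def d_def[symmetric] M_def[symmetric] rpow_square[OF C]
    using Q PQ 1 2 3 by auto
qed

text \<open>The number 16 enters through \<open>16 powr (3 / 2) = 64\<close>, which makes the
  right-hand side \<open>64 ^ d * D\<close>. On the left, \<open>fact d \<le> D\<close> and
  \<open>sqrt d \<le> 2 ^ d\<close> leave at most \<open>4 * 4 ^ d * D\<close>.\<close>

lemma dilation_constant_le:
  assumes "0 < d"
  defines "D \<equiv> rpow (real d) (3 * real d / 2)"
  shows "4 * (sqrt d * (2 ^ (d - 1) * fact d + D)) \<le> rpow (16 * real d) (3 * real d / 2)"
    and "1 \<le> sqrt d * (2 ^ (d - 1) * fact d + D)"
proof -
  have D1: "1 \<le> D" using rpow_ge_one[of 1 d] by (simp add: D_def)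
  have D: "D = real d powr (3 * real d / 2)" using assms by (simp add: D_def rpow_def)
  have "fact d \<le> real d ^ d" using fact_le_power[of d, where 'a = real] by simp
  also have "\<dots> = real d powr real d" using assms by (simp add: powr_realpow)
  also have "\<dots> \<le> D" unfolding D using assms by (intro powr_mono) auto
  finally have f: "fact d \<le> D" .
  have "sqrt d \<le> real d" using assms by (intro real_le_lsqrt) (auto simp: power2_eq_square)
  also have "\<dots> \<le> 2 ^ d" by (simp add: of_nat_less_two_power less_imp_le)
  finally have sq: "sqrt d \<le> 2 ^ d" .
  have "2 ^ (d - 1) * fact d + D \<le> 2 ^ (d - 1) * D + 2 ^ (d - 1) * D"
    using f D1 mult_right_mono[of 1 "2 ^ (d - 1) :: real" D]
    by (intro add_mono mult_left_mono) auto
  also have "\<dots> = 2 ^ d * D" using assms by (cases d) auto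
  finally have "sqrt d * (2 ^ (d - 1) * fact d + D) \<le> 2 ^ d * (2 ^ d * D)"
    using sq D1 by (intro mult_mono) auto
  also have "\<dots> = 4 ^ d * D" by (simp add: power_mult_distrib[symmetric])
  finally have "4 * (sqrt d * (2 ^ (d - 1) * fact d + D)) \<le> 4 * 4 ^ d * D" by simp
  also have "\<dots> \<le> 64 ^ d * D"
  proof -
    have "(4::real) * 4 ^ d \<le> 16 ^ d * 4 ^ d"
      using assms power_increasing[of 1 d "16::real"] by (intro mult_right_mono) auto
    then show ?thesis using D1 by (intro mult_right_mono) (auto simp: power_mult_distrib[symmetric])
  qed
  also have "(64::real) ^ d = 16 powr (3 * real d / 2)"
  proof -
    have "(16::real) powr (3 / 2) = 64"
      using powr_powr[of "4::real" 2 "3/2"] by simp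
    then have "(16::real) powr (3 / 2 * real d) = 64 powr real d"
      by (simp flip: powr_powr)
    then show ?thesis by (simp add: powr_realpow)
  qed
  also have "16 powr (3 * real d / 2) * D = rpow (16 * real d) (3 * real d / 2)"
    using assms by (simp add: D rpow_def powr_mult)
  finally show "4 * (sqrt d * (2 ^ (d - 1) * fact d + D)) \<le> rpow (16 * real d) (3 * real d / 2)" .
  have "1 \<le> 2 ^ (d - 1) * fact d + D" using D1 by (simp add: add_increasing)
  moreover have "1 \<le> sqrt d" using assms by simp
  ultimately show "1 \<le> sqrt d * (2 ^ (d - 1) * fact d + D)"
    using mult_mono[of 1 "sqrt d" 1 "2 ^ (d - 1) * fact d + D"] by simp
qed

section \<open>The containment property with constant 16\<close>

lemma proper_if_rank_zero: "gap_rank P = 0 \<Longrightarrow> proper G P"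
  by (simp add: proper_def coeffs_def)

text \<open>Both inclusions are the case \<open>t' = 1\<close>; for the second, \<open>Q\<close>
  lies in its dilate by \<open>t \<ge> 1\<close>.\<close>

lemma proper_container_imp_subset:
  assumes "proper_container G C P t Q" "1 \<le> t"
  shows "gap_image G P \<subseteq> gap_image G Q"
    "gap_image G Q \<subseteq> gap_image G (dilate (rpow (C * real (gap_rank P)) (3 * real (gap_rank P) / 2) * t) P)"
proof -
  have Q: "sym_gap G Q" "\<And>s. 0 < s \<Longrightarrow> gap_image G (dilate s P) \<subseteq> gap_image G (dilate s Q)"
    "\<And>s. 1 \<le> s \<Longrightarrow> gap_image G (dilate (t * s) Q) \<subseteq>
        gap_image G (dilate (rpow (C * real (gap_rank P)) (3 * real (gap_rank P) / 2) * t * s) P)"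
    using assms(1) by (auto simp: proper_container_def Let_def)
  show "gap_image G P \<subseteq> gap_image G Q" using Q(2)[of 1] by simp
  show "gap_image G Q \<subseteq> gap_image G (dilate (rpow (C * real (gap_rank P)) (3 * real (gap_rank P) / 2) * t) P)"
    using Q(3)[of 1] gap_image_dilate_mono[OF Q(1) assms(2)] by simp
qed

text \<open>If \<open>P\<close> is proper after dilation by \<open>d powr (3 * d / 2) * t\<close>,
  read with \<open>0 powr 0 = 1\<close> as in \<open>rpow\<close>, it is already
  \<open>t\<close>-proper and contains itself. Otherwise a relation is available and the rank drops,
  which also settles the last claim.\<close>

lemma containment_property_16:
  assumes G: "comm_group G" "torsion_free G"
  shows "containment_property 16 G"
proof -
  have lower: "\<exists>Q. gap_rank Q < gap_rank P \<and> proper_container G 16 P t Q"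
    if P: "sym_gap G P" and t: "1 \<le> t"
      and np: "\<not> proper G (dilate (rpow (real (gap_rank P)) (3 * real (gap_rank P) / 2) * t) P)" for P t
  proof -
    define D where "D = rpow (real (gap_rank P)) (3 * real (gap_rank P) / 2)"
    have D: "0 < D" using rpow_ge_one[of 1 "gap_rank P"] by (simp add: D_def)
    have "gap_rank P \<noteq> 0" using np proper_if_rank_zero[of "dilate _ P"] by force
    then have d: "0 < gap_rank P" by simp
    obtain Q where Q: "gap_rank Q < gap_rank P" "sym_gap G Q" "t_proper G t Q"
      "\<And>s. 0 < s \<Longrightarrow> gap_image G (dilate s P) \<subseteq> gap_image G (dilate s Q)"
      "\<And>s. t \<le> s \<Longrightarrow> gap_image G (dilate s Q) \<subseteq>
        gap_image G (dilate (sqrt (gap_rank P) * (2 ^ (gap_rank P - 1) * fact (gap_rank P) + D) * s) P)"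
      using ex_lower_rank_container[OF G P _ D, of t] t np by (auto simp: D_def)
    then show ?thesis
      using proper_containerI[OF G(1) _ P Q(2,3) t _ _ Q(4,5), of 16]
        dilation_constant_le[OF d] by (auto simp: D_def)
  qed
  have "\<exists>Q. gap_rank Q \<le> gap_rank P \<and> proper_container G 16 P t Q" if P: "sym_gap G P" and t: "1 \<le> t" for P t
  proof (cases "proper G (dilate (rpow (real (gap_rank P)) (3 * real (gap_rank P) / 2) * t) P)")
    case True
    define D where "D = rpow (real (gap_rank P)) (3 * real (gap_rank P) / 2)"
    define M where "M = rpow (16 * real (gap_rank P)) (3 * real (gap_rank P) / 2)"
    have D: "1 \<le> D" using rpow_ge_one[of 1 "gap_rank P"] by (simp add: D_def)
    have M: "1 \<le> M" using rpow_ge_one[of 16 "gap_rank P"] by (simp add: M_def)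
    have "t * dims P i \<le> D * t * dims P i" if "i < gap_rank P" for i
      using D t P that by (intro mult_right_mono) (auto simp: sym_gap_def less_imp_le)
    then have "coeffs (dilate t P) \<subseteq> coeffs (dilate (D * t) P)"
      unfolding coeffs_def dilate_simps by (intro PiE_mono) fastforce
    then have tp: "t_proper G t P"
      using True unfolding t_proper_def proper_def D_def[symmetric] by (auto intro: inj_on_subset)
    have "gap_image G (dilate (t * s) P) \<subseteq> gap_image G (dilate (M * t * s) P)" if "1 \<le> s" for s
      using M t that by (intro gap_image_dilate_mono[OF P]) auto
    moreover have "real (gap_size G P) \<le> t ^ gap_rank P * M ^ gap_rank P * real (gap_size G P)"
      using M t mult_mono[of 1 "t ^ gap_rank P" 1 "M ^ gap_rank P"]
        mult_right_mono[of 1 "t ^ gap_rank P * M ^ gap_rank P" "real (gap_size G P)"] by simp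
    ultimately have "proper_container G 16 P t P"
      unfolding proper_container_def Let_def using P tp rpow_square[of 16 "gap_rank P"] by (simp add: M_def)
    then show ?thesis by blast
  next
    case False
    then show ?thesis using lower[OF P t] by (meson less_imp_le)
  qed
  with lower show ?thesis
    unfolding containment_property_def
    using proper_container_imp_subset by meson
qed

subsection \<open>Transfer to countable groups\<close>

text \<open>\<open>P\<close> is the push-forward of \<open>P'\<close> along \<open>h\<close>. Steps
  are compared below the rank only, since beyond it those of a given \<open>P\<close> may lie
  outside the image of \<open>h\<close>.\<close>

definition corresponds :: "('c \<Rightarrow> 'a) \<Rightarrow> 'c gap \<Rightarrow> 'a gap \<Rightarrow> bool" where
  "corresponds h P' P \<longleftrightarrow> gap_rank P = gap_rank P' \<and> dims P = dims P' \<and>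
     (\<forall>i<gap_rank P'. steps P i = h (steps P' i))"

lemma corresponds_dilate: "corresponds h P' P \<Longrightarrow> corresponds h (dilate t P') (dilate t P)"
  by (auto simp: corresponds_def dilate_def)

lemma hom_finprod_lessThan:
  fixes n :: nat
  assumes "comm_group G'" "comm_group G" "h \<in> hom G' G" "\<And>i. i < n \<Longrightarrow> f i \<in> carrier G'"
  shows "h (\<Otimes>\<^bsub>G'\<^esub>i\<in>{..<n}. f i) = (\<Otimes>\<^bsub>G\<^esub>i\<in>{..<n}. h (f i))"
  using assms(4)
proof (induction n)
  interpret G': comm_group G' by fact
  interpret G: comm_group G by fact
  case 0
  then show ?case using hom_one[OF assms(3)] G'.is_group G.is_group by simp
next
  interpret G': comm_group G' by fact
  interpret G: comm_group G by fact
  case (Suc n)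
  then have "h (f i) \<in> carrier G" if "i < Suc n" for i
    using hom_in_carrier[OF assms(3)] that by blast
  then show ?case
    using Suc by (simp add: lessThan_Suc Pi_iff hom_mult[OF assms(3)])
qed

text \<open>The map \<open>h\<close> commutes with forming elements from coefficients, and by
  injectivity the same coefficient functions collide on both sides.\<close>

lemma corresponds_transfer:
  assumes G: "comm_group G'" "comm_group G" and h: "h \<in> hom G' G" "inj_on h (carrier G')"
    and P: "corresponds h P' P" "\<And>i. i < gap_rank P' \<Longrightarrow> steps P' i \<in> carrier G'"
  shows "gap_image G' P' \<subseteq> carrier G'"
    "gap_image G P = h ` gap_image G' P'"
    "gap_size G P = gap_size G' P'"
    "proper G P \<longleftrightarrow> proper G' P'"
proof -
  interpret G': comm_group G' by fact
  interpret G: comm_group G by fact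
  have cl: "gap_elem G' P' n \<in> carrier G'" for n
    unfolding gap_elem_def using P(2) by (auto intro!: G'.finprod_closed)
  then show sub: "gap_image G' P' \<subseteq> carrier G'" by (auto simp: gap_image_def)
  have elem: "gap_elem G P n = h (gap_elem G' P' n)" for n
  proof -
    have "h (gap_elem G' P' n) = (\<Otimes>\<^bsub>G\<^esub>i\<in>{..<gap_rank P'}. h (steps P' i [^]\<^bsub>G'\<^esub> n i))"
      unfolding gap_elem_def using P(2) by (intro hom_finprod_lessThan[OF G h(1)]) auto
    also have "\<dots> = gap_elem G P n"
      unfolding gap_elem_def using P hom_in_carrier[OF h(1)]
      by (intro G.finprod_cong')
        (auto simp: corresponds_def hom_int_pow[OF h(1) _ G'.is_group G.is_group])
    finally show ?thesis ..
  qed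
  have co: "coeffs P = coeffs P'" using P(1) by (simp add: corresponds_def coeffs_def)
  show img: "gap_image G P = h ` gap_image G' P'"
    by (auto simp: gap_image_def elem co)
  show "gap_size G P = gap_size G' P'"
    unfolding gap_size_def img using sub h(2) by (intro card_image) (rule inj_on_subset)
  show "proper G P \<longleftrightarrow> proper G' P'"
    using h(2) cl unfolding proper_def co inj_on_def elem by metis
qed

lemma proper_container_transfer:
  assumes G: "comm_group G'" "comm_group G" and h: "h \<in> hom G' G" "inj_on h (carrier G')"
    and P: "corresponds h P' P" "sym_gap G' P'" and Q': "proper_container G' C P' t Q'"
  shows "\<exists>Q. gap_rank Q = gap_rank Q' \<and> proper_container G C P t Q"
proof -
  define Q where "Q = GAP (dims Q') (h \<circ> steps Q') (gap_rank Q')"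
  have Q: "corresponds h Q' Q" by (simp add: corresponds_def Q_def)
  have symQ': "sym_gap G' Q'" using Q' by (simp add: proper_container_def Let_def)
  then have symQ: "sym_gap G Q"
    using hom_in_carrier[OF h(1)] by (auto simp: sym_gap_def Q_def)
  have rP: "gap_rank P = gap_rank P'" using P(1) by (simp add: corresponds_def)
  have stP: "\<And>i. i < gap_rank P' \<Longrightarrow> steps P' i \<in> carrier G'" using P(2) by (simp add: sym_gap_def)
  have stQ: "\<And>i. i < gap_rank Q' \<Longrightarrow> steps Q' i \<in> carrier G'" using symQ' by (simp add: sym_gap_def)
  have sz: "gap_size G P = gap_size G' P'" "gap_size G Q = gap_size G' Q'"
    using corresponds_transfer(3)[OF G h] P(1) Q stP stQ by auto
  have img: "gap_image G (dilate s P) = h ` gap_image G' (dilate s P')"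
    "gap_image G (dilate s Q) = h ` gap_image G' (dilate s Q')" for s
    using corresponds_transfer(2)[OF G h corresponds_dilate] P(1) Q stP stQ by auto
  have "proper G (dilate t Q) \<longleftrightarrow> proper G' (dilate t Q')"
    using corresponds_transfer(4)[OF G h corresponds_dilate[OF Q]] stQ by auto
  then have "proper_container G C P t Q"
    using Q' symQ by (simp add: proper_container_def Let_def t_proper_def rP img sz image_mono)
  moreover have "gap_rank Q = gap_rank Q'" by (simp add: Q_def)
  ultimately show ?thesis by blast
qed

text \<open>The steps of \<open>P\<close> generate a countable subgroup \<open>H\<close>. Numbering
  it by \<open>f\<close> and copying the multiplication gives a group \<open>N\<close> on naturals,
  embedded in \<open>G\<close> by the inverse \<open>h\<close> of the numbering.\<close>

lemma ex_nat_group: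
  fixes G :: "('a, 'm) monoid_scheme"
  assumes G: "comm_group G" "torsion_free G" and P: "sym_gap G P"
  shows "\<exists>(N :: nat monoid) h P'. comm_group N \<and> torsion_free N \<and> h \<in> hom N G \<and>
           inj_on h (carrier N) \<and> corresponds h P' P \<and> sym_gap N P'"
proof -
  interpret G: comm_group G by fact
  define d where "d = gap_rank P"
  define H where "H = range (gap_elem G P)"
  \<comment> \<open>A combination depends on \<open>d\<close> integers only, hence on a list, and
    lists of integers are countable.\<close>
  have "gap_elem G P n = gap_elem G P ((!) (map n [0..<d]))" for n
    by (rule gap_elem_cong[OF G(1) P]) (simp add: d_def)
  then have "H \<subseteq> range (\<lambda>l. gap_elem G P ((!) l))" unfolding H_def by blast
  then have cH: "countable H" by (rule countable_subset) simp
  have add: "gap_elem G P m \<otimes>\<^bsub>G\<^esub> gap_elem G P n \<in> H" for m n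
    unfolding H_def by (simp flip: gap_elem_add[OF G(1) P])
  have zero: "gap_elem G P (\<lambda>_. 0) = \<one>\<^bsub>G\<^esub>"
    unfolding gap_elem_def by (simp add: int_pow_0 G.finprod_one_eqI)
  have "subgroup H G"
  proof (rule G.subgroupI)
    show "H \<subseteq> carrier G" using gap_elem_closed[OF G(1) P] by (auto simp: H_def)
    show "H \<noteq> {}" by (simp add: H_def)
    fix a assume "a \<in> H"
    then obtain n where n: "a = gap_elem G P n" by (auto simp: H_def)
    have "gap_elem G P (\<lambda>i. - n i) \<otimes>\<^bsub>G\<^esub> a = \<one>\<^bsub>G\<^esub>"
      unfolding n gap_elem_add[OF G(1) P, symmetric] by (simp add: zero)
    then have "inv\<^bsub>G\<^esub> a = gap_elem G P (\<lambda>i. - n i)"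
      using n gap_elem_closed[OF G(1) P] by (metis G.inv_equality)
    then show "inv\<^bsub>G\<^esub> a \<in> H" by (simp add: H_def)
  next
    fix a b assume "a \<in> H" "b \<in> H"
    then show "a \<otimes>\<^bsub>G\<^esub> b \<in> H" using add by (auto simp: H_def)
  qed
  then interpret H: subgroup H G .
  define GH where "GH = G\<lparr>carrier := H\<rparr>"
  interpret GH: comm_group GH
    unfolding GH_def
    by (intro group.group_comm_groupI H.subgroup_is_group G.is_group) (auto intro: G.m_comm H.mem_carrier)
  define f where "f = to_nat_on H"
  define h where "h = inv_into H f"
  have inj: "inj_on f H" unfolding f_def by (rule inj_on_to_nat_on[OF cH])
  have hf: "h (f x) = x" if "x \<in> H" for x
    unfolding h_def using inj that by (rule inv_into_f_f)
  define N where "N = \<lparr>carrier = f ` H, monoid.mult = (\<lambda>a b. f (h a \<otimes>\<^bsub>G\<^esub> h b)), one = f \<one>\<^bsub>G\<^esub>\<rparr>"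
  \<comment> \<open>\<open>f\<close> is a homomorphism into a structure without known laws; its
    image inherits the laws of a commutative group from \<open>GH\<close>, and this image is
    \<open>N\<close>.\<close>
  have "f \<in> hom GH (N\<lparr>carrier := UNIV\<rparr>)"
    by (rule homI) (auto simp: N_def GH_def hf)
  then have "comm_group (N\<lparr>carrier := UNIV, carrier := f ` carrier GH, one := f \<one>\<^bsub>GH\<^esub>\<rparr>)"
    using GH.hom_imp_img_comm_group by fastforce
  then have N: "comm_group N" by (simp add: N_def GH_def)
  have cN: "carrier N = f ` H" by (simp add: N_def)
  have hom: "h \<in> hom N G"
    by (rule homI) (auto simp: N_def hf)
  have injh: "inj_on h (carrier N)"
    by (auto simp: cN hf inj_on_def)
  interpret N: comm_group N by fact
  have one: "h \<one>\<^bsub>N\<^esub> = \<one>\<^bsub>G\<^esub>" using hom_one[OF hom N.is_group G.is_group] .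
  have tf: "torsion_free N"
    unfolding torsion_free_def
  proof (intro ballI allI impI notI)
    fix x and n :: int assume x: "x \<in> carrier N" "x \<noteq> \<one>\<^bsub>N\<^esub>" "n \<noteq> 0" "x [^]\<^bsub>N\<^esub> n = \<one>\<^bsub>N\<^esub>"
    then have "h x [^]\<^bsub>G\<^esub> n = \<one>\<^bsub>G\<^esub>"
      using hom_int_pow[OF hom x(1) N.is_group G.is_group, of n] one by simp
    moreover have "h x \<noteq> \<one>\<^bsub>G\<^esub>"
      using x(1,2) one injh by (metis N.one_closed inj_onD)
    ultimately show False
      using G(2) x(1,3) hom_in_carrier[OF hom] unfolding torsion_free_def by blast
  qed
  define P' where "P' = GAP (dims P) (f \<circ> steps P) d"
  have st: "steps P i \<in> H" if "i < d" for i
  proof -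
    have "gap_elem G P (\<lambda>j. if j = i then 1 else 0) =
        (\<Otimes>\<^bsub>G\<^esub>j\<in>{..<d}. if i = j then steps P j else \<one>\<^bsub>G\<^esub>)"
      unfolding gap_elem_def d_def[symmetric]
      using P by (intro G.finprod_cong') (auto simp: sym_gap_def d_def int_pow_0 G.int_pow_1)
    also have "\<dots> = steps P i"
      using P that by (intro G.finprod_singleton) (auto simp: sym_gap_def d_def)
    finally show ?thesis unfolding H_def by (metis rangeI)
  qed
  have "corresponds h P' P"
    using st by (simp add: corresponds_def P'_def d_def hf)
  moreover have "sym_gap N P'"
    using P st by (auto simp: sym_gap_def P'_def cN d_def)
  ultimately show ?thesis using N tf hom injh by blast
qed

text \<open>For each \<open>P\<close>, the subgroup generated by its steps has a copy on the
  naturals; containers found in the copy are pushed forward to \<open>G\<close> with the same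
  constant.\<close>

lemma containment_property_transfer:
  fixes G :: "('a, 'm) monoid_scheme"
  assumes C: "\<And>N :: nat monoid. comm_group N \<Longrightarrow> torsion_free N \<Longrightarrow> containment_property C N"
    and G: "comm_group G" "torsion_free G"
  shows "containment_property C G"
  unfolding containment_property_def
proof (intro allI impI)
  fix P :: "'a gap" and t :: real
  assume P: "sym_gap G P" and t: "1 \<le> t"
  obtain N :: "nat monoid" and h P' where N: "comm_group N" "torsion_free N"
    and h: "h \<in> hom N G" "inj_on h (carrier N)" and P': "corresponds h P' P" "sym_gap N P'"
    using ex_nat_group[OF G P] by blast
  have rk: "gap_rank P' = gap_rank P" using P'(1) by (simp add: corresponds_def)
  have pr: "proper N (dilate s P') \<longleftrightarrow> proper G (dilate s P)" for s
    using corresponds_transfer(4)[OF N(1) G(1) h corresponds_dilate[OF P'(1)]] P'(2)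
    by (simp add: sym_gap_def)
  have Q: "\<exists>Q. gap_rank Q = gap_rank Q' \<and> proper_container G C P t Q" if "proper_container N C P' t Q'" for Q'
    by (rule proper_container_transfer[OF N(1) G(1) h P' that])
  have "\<exists>Q'. gap_rank Q' \<le> gap_rank P \<and> proper_container N C P' t Q'"
    and lower: "\<not> proper G (dilate (rpow (real (gap_rank P)) (3 * real (gap_rank P) / 2) * t) P) \<Longrightarrow>
      \<exists>Q'. gap_rank Q' < gap_rank P \<and> proper_container N C P' t Q'"
    using C[OF N] P'(2) t unfolding containment_property_def rk pr[symmetric] by (metis rk)+
  then obtain Q1 where "gap_rank Q1 \<le> gap_rank P" "proper_container G C P t Q1"
    using Q by metis
  moreover have "\<not> proper G (dilate (rpow (real (gap_rank P)) (3 * real (gap_rank P) / 2) * t) P) \<longrightarrow>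
      (\<exists>Q. gap_rank Q < gap_rank P \<and> proper_container G C P t Q)"
    using lower Q by metis
  ultimately show "(\<exists>Q. gap_rank Q \<le> gap_rank P \<and> proper_container G C P t Q \<and>
          gap_image G P \<subseteq> gap_image G Q \<and>
          gap_image G Q
            \<subseteq> gap_image G (dilate (rpow (C * real (gap_rank P)) (3 * real (gap_rank P) / 2) * t) P)) \<and>
       (\<not> proper G (dilate (rpow (real (gap_rank P)) (3 * real (gap_rank P) / 2) * t) P) \<longrightarrow>
          (\<exists>Q. gap_rank Q < gap_rank P \<and> proper_container G C P t Q))"
    using proper_container_imp_subset[OF _ t] by blast
qed

text \<open>The witness 16 shows that the condition in the choice is satisfiable, so the chosen
  constant satisfies it; its value remains unspecified.\<close>

lemma gap_const_spec:
  "gap_const > 0 \<and>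
   (\<forall>G :: nat monoid. comm_group G \<longrightarrow> torsion_free G \<longrightarrow> containment_property gap_const G)"
  unfolding gap_const_def
  by (rule someI[of _ 16]) (simp add: containment_property_16)

theorem corollary1p11:
  "gap_const > 0 \<and>
   (\<forall>G :: ('a, 'm) monoid_scheme. comm_group G \<longrightarrow> torsion_free G \<longrightarrow>
      (\<forall>P t. sym_gap G P \<longrightarrow> 1 \<le> t \<longrightarrow>
        (\<exists>Q. gap_rank Q \<le> gap_rank P \<and> proper_container G gap_const P t Q \<and>
           gap_image G P \<subseteq> gap_image G Q \<and>
           gap_image G Q
             \<subseteq> gap_image G (dilate (rpow (gap_const * real (gap_rank P)) (3 * real (gap_rank P) / 2) * t) P)) \<and>
        (\<not> proper G (dilate (rpow (real (gap_rank P)) (3 * real (gap_rank P) / 2) * t) P) \<longrightarrow>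
           (\<exists>Q. gap_rank Q < gap_rank P \<and> proper_container G gap_const P t Q))))"
  \<comment> \<open>The clauses on \<open>P\<close> and \<open>t\<close> fold into
    \<open>containment_property\<close>, known for groups on the naturals and transferred to
    arbitrary carriers.\<close>
  unfolding containment_property_def[symmetric]
  using gap_const_spec containment_property_transfer[of gap_const] by blast

end
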